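(* Let $\lambda$ be any element of the coroot lattice $R^\vee$. For any $y\in W$ and $s\in S$ such that $\ell(ys)>\ell(y)$, we have $$\mathrm{Sh}_{\mathbf{ys}}(\lambda)=\mathrm{Sh}_{\mathbf y}(\lambda)\,\cup\, r_H\bigl(H^{ys}\cap \mathrm{Sh}_{\mathbf y}(\lambda)\bigr),$$ where $H$ is the hyperplane separating the alcoves $\mathbf y=y\mathbf c_f$ and $\mathbf{ys}=ys\,\mathbf c_f$, $r_H$ is the reflection of the apartment in $H$, and $H^{ys}$ is the closed half-apartment which is bounded by $H$ and contains $\mathbf{ys}$.
   Context: Let $(W,S)$ be an irreducible affine Coxeter system, $S=\{s_0,\dots,s_n\}$, acting on $n$-dimensional Euclidean space $V$ with origin $v_0$; $\ell$ is the length function. $W_0=\langle s_1,\dots,s_n\rangle$ is the stabilizer of $v_0$ in $W$; $\Phi$ is a crystallographic root system with Weyl group $W_0$, with positive roots $\Phi^+$, simple roots $\alpha_1,\dots,\alpha_n$, highest root $\widetilde\alpha$ and coroot lattice $R^\vee\subset V$, such that $W=R^\vee\rtimes W_0$ (with $\lambda\in R^\vee$ acting as the translation $t^\lambda$), $s_i=s_{\alpha_i}$ for $i\ge 1$, and $s_0$ is the reflection in $H_{\widetilde\alpha,1}$. Hyperplanes are $H_{\alpha,k}=\{v\in V:\langle\alpha,v\rangle=k\}$, $\alpha\in\Phi$, $k\in\mathbb Z$. Alcoves are closures of the connected components of the complement of all hyperplanes; the fundamental alcove $\mathbf c_f$ is the one bounded by $H_{\alpha_1,0},\dots,H_{\alpha_n,0},H_{\widetilde\alpha,1}$;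 for $x\in W$ put $\mathbf x=x\mathbf c_f$. Fix an apartment $A$ of an affine building of type $(W,S)$, identified with $V$. A panel is a codimension-one face of an alcove; each panel spans a unique (supporting) hyperplane. Each simplex has a $W$-invariant type, a subset of $S$; the panel shared by $x\mathbf c_f$ and $xs\mathbf c_f$ has type $s$. A combinatorial gallery is a sequence $\gamma=(p_0,c_0,p_1,c_1,\dots,p_l,c_l,p_{l+1})$, with $c_i$ alcoves, $p_0\subseteq c_0$ and $p_{l+1}\subseteq c_l$ simplices, and for $1\le i\le l$ the face $p_i$ a panel of both $c_{i-1}$ and $c_i$. Its length is $l+1$; it is minimal if it has minimal length among galleries with first face $p_0$ and last face $p_{l+1}$. Its type is $(\mathrm{type}(p_0),s_{j_1},\dots,s_{j_l},\mathrm{type}(p_{l+1}))$ where $p_i$ has type $s_{j_i}$. It is folded at $p_i$ ($1\le i\le l$) if $c_{i-1}=c_i$. For $\lambda\in R^\vee$, fix a minimal gallery in $A$ from the origin $v_0$ to $\lambda$; galleries of the same type as this one with first face $v_0$ are said to have type $\vec\lambda$. For $y\in W$, the shadow $\mathrm{Sh}_{\mathbf y}(\lambda)\subseteq R^\vee$ is the set of end-vertices of all galleries in $A$ of type $\vec\lambda$ with first face $v_0$ which are positively folded (folded away from $\mathbf y$): whenever the gallery is folded at $p_i$, the hyperplane supporting $p_i$ separates $c_i$ from $\mathbf y$. *)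

theory Defs
  imports "HOL-Analysis.Analysis" "HOL-Computational_Algebra.Group_Closure"
begin

section \<open>Root systems and the affine Weyl group\<close>

text \<open>
  The Euclidean space \<open>V\<close> is a type of class \<^class>\<open>euclidean_space\<close>, of dimension \<open>DIM('a)\<close>,
  with origin \<open>0\<close>. Roots are vectors of \<open>V\<close>, the pairing with a root being the inner product.
\<close>

definition coroot :: "'a::euclidean_space \<Rightarrow> 'a" where
  "coroot \<alpha> = (2 / (\<alpha> \<bullet> \<alpha>)) *\<^sub>R \<alpha>"

definition hyperplane :: "'a::euclidean_space \<Rightarrow> real \<Rightarrow> 'a set" where
  "hyperplane \<alpha> k = {v. \<alpha> \<bullet> v = k}"

definition affine_refl :: "'a::euclidean_space \<Rightarrow> real \<Rightarrow> 'a \<Rightarrow> 'a" where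
  "affine_refl \<alpha> k v = v - (\<alpha> \<bullet> v - k) *\<^sub>R coroot \<alpha>"

definition root_system :: "'a::euclidean_space set \<Rightarrow> bool" where
  "root_system \<Phi> \<longleftrightarrow>
     finite \<Phi> \<and> 0 \<notin> \<Phi> \<and> span \<Phi> = UNIV \<and>
     (\<forall>\<alpha>\<in>\<Phi>. \<forall>\<beta>\<in>\<Phi>. affine_refl \<alpha> 0 \<beta> \<in> \<Phi>) \<and>
     (\<forall>\<alpha>\<in>\<Phi>. \<forall>\<beta>\<in>\<Phi>. \<alpha> \<bullet> coroot \<beta> \<in> \<int>) \<and>
     (\<forall>\<alpha>\<in>\<Phi>. \<forall>c. c *\<^sub>R \<alpha> \<in> \<Phi> \<longrightarrow> c = 1 \<or> c = -1)"

definition irreducible_root_system :: "'a::euclidean_space set \<Rightarrow> bool" where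
  "irreducible_root_system \<Phi> \<longleftrightarrow>
     root_system \<Phi> \<and> \<Phi> \<noteq> {} \<and>
     \<not> (\<exists>A B. A \<noteq> {} \<and> B \<noteq> {} \<and> A \<union> B = \<Phi> \<and> A \<inter> B = {} \<and> (\<forall>a\<in>A. \<forall>b\<in>B. a \<bullet> b = 0))"

definition nonneg_combinations :: "'a::euclidean_space set \<Rightarrow> 'a set" where
  "nonneg_combinations \<Delta> = {v. \<exists>c :: 'a \<Rightarrow> nat. v = (\<Sum>\<alpha>\<in>\<Delta>. real (c \<alpha>) *\<^sub>R \<alpha>)}"

definition positive_roots :: "'a::euclidean_space set \<Rightarrow> 'a set \<Rightarrow> 'a set" where
  "positive_roots \<Phi> \<Delta> = \<Phi> \<inter> nonneg_combinations \<Delta>"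

definition simple_roots :: "'a::euclidean_space set \<Rightarrow> 'a set \<Rightarrow> bool" where
  "simple_roots \<Phi> \<Delta> \<longleftrightarrow>
     \<Delta> \<subseteq> \<Phi> \<and> independent \<Delta> \<and>
     (\<forall>\<beta>\<in>\<Phi>. \<beta> \<in> positive_roots \<Phi> \<Delta> \<or> - \<beta> \<in> positive_roots \<Phi> \<Delta>)"

definition highest_root :: "'a::euclidean_space set \<Rightarrow> 'a set \<Rightarrow> 'a \<Rightarrow> bool" where
  "highest_root \<Phi> \<Delta> \<theta> \<longleftrightarrow> \<theta> \<in> \<Phi> \<and> (\<forall>\<beta>\<in>\<Phi>. \<theta> - \<beta> \<in> nonneg_combinations \<Delta>)"

definition coroot_lattice :: "'a::euclidean_space set \<Rightarrow> 'a set" where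
  "coroot_lattice \<Phi> = group_closure (coroot ` \<Phi>)"

definition simple_reflections :: "'a::euclidean_space set \<Rightarrow> 'a \<Rightarrow> ('a \<Rightarrow> 'a) set" where
  "simple_reflections \<Delta> \<theta> = insert (affine_refl \<theta> 1) ((\<lambda>\<alpha>. affine_refl \<alpha> 0) ` \<Delta>)"

definition word_prod :: "('a \<Rightarrow> 'a) list \<Rightarrow> 'a \<Rightarrow> 'a" where
  "word_prod ws = foldr (\<circ>) ws id"

text \<open>
  The group generated by the simple reflections; since these are involutions, words in them
  need no inverses. As a group of affine maps it is the semidirect product of the translations
  by the coroot lattice and the finite Weyl group.
\<close>

definition affine_weyl_group :: "'a::euclidean_space set \<Rightarrow> 'a \<Rightarrow> ('a \<Rightarrow> 'a) set" where
  "affine_weyl_group \<Delta> \<theta> = word_prod ` lists (simple_reflections \<Delta> \<theta>)"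

definition coxeter_length :: "'a::euclidean_space set \<Rightarrow> 'a \<Rightarrow> ('a \<Rightarrow> 'a) \<Rightarrow> nat" where
  "coxeter_length \<Delta> \<theta> w =
     (LEAST k. \<exists>ws \<in> lists (simple_reflections \<Delta> \<theta>). length ws = k \<and> word_prod ws = w)"

section \<open>Alcoves, simplices and their types\<close>

definition walls :: "'a::euclidean_space set \<Rightarrow> 'a set set" where
  "walls \<Phi> = {hyperplane \<alpha> (of_int k) | \<alpha> k. \<alpha> \<in> \<Phi>}"

definition alcoves :: "'a::euclidean_space set \<Rightarrow> 'a set set" where
  "alcoves \<Phi> = closure ` components (- \<Union> (walls \<Phi>))"

definition fundamental_alcove :: "'a::euclidean_space set \<Rightarrow> 'a \<Rightarrow> 'a set" where
  "fundamental_alcove \<Delta> \<theta> = {v. (\<forall>\<alpha>\<in>\<Delta>. 0 \<le> \<alpha> \<bullet> v) \<and> \<theta> \<bullet> v \<le> 1}"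

definition apartment_simplex :: "'a::euclidean_space set \<Rightarrow> 'a set \<Rightarrow> bool" where
  "apartment_simplex \<Phi> F \<longleftrightarrow> F \<noteq> {} \<and> (\<exists>c\<in>alcoves \<Phi>. F face_of c)"

text \<open>
  The type of a face \<open>G\<close> of the fundamental alcove is the set of simple reflections whose wall
  contains \<open>G\<close>, extended to all simplices by invariance under the affine Weyl group. So the panel
  between \<open>x\<close> and \<open>xs\<close> has type \<open>{s}\<close>, the origin has type \<open>{s\<^sub>1, \<dots>, s\<^sub>n}\<close> and alcoves have
  type \<open>{}\<close>.
\<close>

definition simplex_type :: "'a::euclidean_space set \<Rightarrow> 'a \<Rightarrow> 'a set \<Rightarrow> ('a \<Rightarrow> 'a) set" where
  "simplex_type \<Delta> \<theta> F =
     {s \<in> simple_reflections \<Delta> \<theta>.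
        \<exists>w \<in> affine_weyl_group \<Delta> \<theta>. \<exists>G. G face_of fundamental_alcove \<Delta> \<theta> \<and>
          F = w ` G \<and> (\<forall>v\<in>G. s v = v)}"

text \<open>Both notions below are meant for sets with nonempty interior, such as alcoves.\<close>

definition separates :: "'a::euclidean_space set \<Rightarrow> 'a set \<Rightarrow> 'a set \<Rightarrow> bool" where
  "separates H C D \<longleftrightarrow>
     (\<exists>a b. a \<noteq> 0 \<and> H = {v. a \<bullet> v = b} \<and> C \<subseteq> {v. a \<bullet> v \<le> b} \<and> D \<subseteq> {v. a \<bullet> v \<ge> b})"

definition half_apartment :: "'a::euclidean_space set \<Rightarrow> 'a set \<Rightarrow> 'a set" where
  "half_apartment H C =
     {x. \<exists>a b. a \<noteq> 0 \<and> H = {v. a \<bullet> v = b} \<and> C \<subseteq> {v. a \<bullet> v \<le> b} \<and> a \<bullet> x \<le> b}"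

section \<open>Galleries and shadows\<close>

text \<open>
  A gallery \<open>(p\<^sub>0, c\<^sub>0, p\<^sub>1, c\<^sub>1, \<dots>, p\<^sub>l, c\<^sub>l, p\<^sub>l\<^sub>+\<^sub>1)\<close> is given by the list of its \<open>l + 2\<close> faces \<open>p\<^sub>i\<close>
  and the list of its \<open>l + 1\<close> alcoves \<open>c\<^sub>i\<close>.
\<close>

type_synonym 'a gallery = "'a set list \<times> 'a set list"

abbreviation faces :: "'a gallery \<Rightarrow> 'a set list" where "faces \<equiv> fst"
abbreviation chambers :: "'a gallery \<Rightarrow> 'a set list" where "chambers \<equiv> snd"
abbreviation first_face :: "'a gallery \<Rightarrow> 'a set" where "first_face g \<equiv> hd (faces g)"
abbreviation last_face :: "'a gallery \<Rightarrow> 'a set" where "last_face g \<equiv> last (faces g)"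
abbreviation gallery_length :: "'a gallery \<Rightarrow> nat" where "gallery_length g \<equiv> length (chambers g)"

definition is_gallery :: "'a::euclidean_space set \<Rightarrow> 'a gallery \<Rightarrow> bool" where
  "is_gallery \<Phi> g \<longleftrightarrow>
     chambers g \<noteq> [] \<and> length (faces g) = Suc (length (chambers g)) \<and>
     set (chambers g) \<subseteq> alcoves \<Phi> \<and>
     apartment_simplex \<Phi> (first_face g) \<and> first_face g \<subseteq> hd (chambers g) \<and>
     apartment_simplex \<Phi> (last_face g) \<and> last_face g \<subseteq> last (chambers g) \<and>
     (\<forall>i. 1 \<le> i \<and> i < length (chambers g) \<longrightarrow>
        faces g ! i facet_of chambers g ! (i - 1) \<and> faces g ! i facet_of chambers g ! i)"

definition minimal_gallery :: "'a::euclidean_space set \<Rightarrow> 'a gallery \<Rightarrow> bool" where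
  "minimal_gallery \<Phi> g \<longleftrightarrow>
     is_gallery \<Phi> g \<and>
     (\<forall>g'. is_gallery \<Phi> g' \<and> first_face g' = first_face g \<and> last_face g' = last_face g \<longrightarrow>
        gallery_length g \<le> gallery_length g')"

definition gallery_type :: "'a::euclidean_space set \<Rightarrow> 'a \<Rightarrow> 'a gallery \<Rightarrow> ('a \<Rightarrow> 'a) set list" where
  "gallery_type \<Delta> \<theta> g = map (simplex_type \<Delta> \<theta>) (faces g)"

definition folded_at :: "'a gallery \<Rightarrow> nat \<Rightarrow> bool" where
  "folded_at g i \<longleftrightarrow>
     1 \<le> i \<and> i < length (chambers g) \<and> chambers g ! (i - 1) = chambers g ! i"

definition positively_folded :: "'a::euclidean_space set \<Rightarrow> 'a gallery \<Rightarrow> bool" where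
  "positively_folded C g \<longleftrightarrow>
     (\<forall>i. folded_at g i \<longrightarrow> separates (affine hull (faces g ! i)) (chambers g ! i) C)"

text \<open>
  The shadow with respect to the alcove \<open>y\<close> of the type of the gallery \<open>g\<^sub>0\<close>, which is the chosen
  minimal gallery from the origin to \<open>\<lambda>\<close> when the shadow is that of \<open>\<lambda>\<close>.
\<close>

definition shadow ::
  "'a::euclidean_space set \<Rightarrow> 'a set \<Rightarrow> 'a \<Rightarrow> 'a gallery \<Rightarrow> ('a \<Rightarrow> 'a) \<Rightarrow> 'a set" where
  "shadow \<Phi> \<Delta> \<theta> g\<^sub>0 y =
     {v. \<exists>g. is_gallery \<Phi> g \<and> first_face g = {0} \<and> last_face g = {v} \<and>
             gallery_type \<Delta> \<theta> g = gallery_type \<Delta> \<theta> g\<^sub>0 \<and>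
             positively_folded (y ` fundamental_alcove \<Delta> \<theta>) g}"

end

theory Submission
  imports Defs
begin

text \<open>
  The panels lying in \<open>H\<close> cut a gallery into pieces, each on one side of \<open>H\<close>, and every piece may
  be reflected in \<open>H\<close> independently of the others without changing the type of the gallery. Folds
  at walls other than \<open>H\<close> stay positive: such a wall does not separate \<open>y\<close> from \<open>ys\<close>, which \<open>r\<^sub>H\<close>
  interchanges. So positivity only constrains the sides of the pieces: for \<open>y\<close> it suffices that
  no two consecutive ones lie on the side of \<open>y\<close>, and likewise for \<open>ys\<close>. The length condition
  places the origin on the closed side of \<open>y\<close>, so that the first piece may be put there. Moving all
  pieces, or all but the last, to the side of \<open>y\<close> gives one inclusion, and moving all but the first
  to the side of \<open>ys\<close> gives the other.
\<close>

section \<open>Hyperplanes and affine isometries\<close>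

lemma hyperplane_eq_imp_scaled:
  fixes a a' :: "'a::euclidean_space"
  assumes "a \<noteq> 0" "a' \<noteq> 0" and eq: "{v. a \<bullet> v = b} = {v. a' \<bullet> v = b'}"
  obtains c where "c \<noteq> 0" "a' = c *\<^sub>R a" "b' = c * b"
proof -
  define x where "x = (b / (a \<bullet> a)) *\<^sub>R a"
  define u where "u = a' - (a \<bullet> a' / (a \<bullet> a)) *\<^sub>R a"
  define c where "c = a \<bullet> a' / (a \<bullet> a)"
  have x: "a \<bullet> x = b" and u: "a \<bullet> u = 0"
    using \<open>a \<noteq> 0\<close> by (simp_all add: x_def u_def inner_diff_right)
  have "x \<in> {v. a' \<bullet> v = b'}" "x + u \<in> {v. a' \<bullet> v = b'}"
    using x u by (simp_all add: eq[symmetric] inner_add_right)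
  then have x': "a' \<bullet> x = b'" and "a' \<bullet> u = 0"
    by (simp_all add: inner_add_right)
  then have "u \<bullet> u = 0"
    using u by (simp add: u_def inner_diff_left)
  then have a': "a' = c *\<^sub>R a"
    by (simp add: u_def c_def)
  show thesis
    using that[of c] a' x x' \<open>a' \<noteq> 0\<close> by auto
qed

definition affine_isometry :: "('a::euclidean_space \<Rightarrow> 'a) \<Rightarrow> bool" where
  "affine_isometry w \<longleftrightarrow> (\<exists>f t. orthogonal_transformation f \<and> w = (\<lambda>v. t + f v))"

lemma affine_isometryE:
  assumes "affine_isometry w"
  obtains f t where "orthogonal_transformation f" "linear f" "inj f" "w = (+) t \<circ> f"
  using assms orthogonal_transformation_inj orthogonal_transformation_linear
  unfolding affine_isometry_def comp_def by metis

lemma affine_isometry_id: "affine_isometry id"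
  unfolding affine_isometry_def
  by (intro exI[of _ id] exI[of _ 0]) (auto simp: orthogonal_transformation_id id_def)

lemma affine_isometry_comp:
  assumes "affine_isometry w" "affine_isometry w'"
  shows "affine_isometry (w \<circ> w')"
proof -
  obtain f t where f: "orthogonal_transformation f" "linear f" "w = (+) t \<circ> f"
    using affine_isometryE[OF assms(1)] by metis
  obtain f' t' where f': "orthogonal_transformation f'" "linear f'" "w' = (+) t' \<circ> f'"
    using affine_isometryE[OF assms(2)] by metis
  have "w \<circ> w' = (\<lambda>v. (t + f t') + (f \<circ> f') v)"
    using f f' by (auto simp: linear_add)
  then show ?thesis
    unfolding affine_isometry_def
    using orthogonal_transformation_compose[OF f(1) f'(1)] by blast
qed

lemma affine_isometry_continuous_on:
  assumes "affine_isometry w"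
  shows "continuous_on S w"
proof -
  obtain f t where f: "linear f" "w = (+) t \<circ> f"
    using affine_isometryE[OF assms] by metis
  have "continuous_on S f"
    using f(1) by (simp add: linear_continuous_on linear_conv_bounded_linear)
  then show ?thesis
    unfolding f(2) comp_def by (rule continuous_on_add[OF continuous_on_const])
qed

lemma facet_of_affine_isometry:
  assumes "affine_isometry w"
  shows "w ` F face_of w ` S \<longleftrightarrow> F face_of S" "w ` F facet_of w ` S \<longleftrightarrow> F facet_of S"
proof -
  obtain f t where f: "linear f" "inj f" "w = (+) t \<circ> f"
    using affine_isometryE[OF assms] by metis
  show "w ` F face_of w ` S \<longleftrightarrow> F face_of S"
    unfolding f(3) image_comp[symmetric] using f by (simp only: face_of_translation_eq face_of_linear_image)
  then show "w ` F facet_of w ` S \<longleftrightarrow> F facet_of S"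
    unfolding f(3) image_comp[symmetric] facet_of_def
    using f by (simp only: image_is_empty aff_dim_translation_eq aff_dim_injective_linear_image)
qed

lemma affine_hull_affine_isometry:
  assumes "affine_isometry w"
  shows "affine hull (w ` S) = w ` (affine hull S)"
proof -
  obtain f t where f: "linear f" "inj f" "w = (+) t \<circ> f"
    using affine_isometryE[OF assms] by metis
  show ?thesis
    unfolding f(3) image_comp[symmetric] affine_hull_translation
    using affine_hull_linear_image[of f S] f(1) by (simp only: linear_conv_bounded_linear)
qed

lemma closure_affine_isometry:
  assumes "affine_isometry w"
  shows "closure (w ` S) = w ` closure S"
proof -
  obtain f t where f: "linear f" "inj f" "w = (+) t \<circ> f"
    using affine_isometryE[OF assms] by metis
  show ?thesis
    unfolding f(3) image_comp[symmetric] closure_translation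
    by (simp only: closure_injective_linear_image[OF f(1,2)])
qed

lemma affine_isometry_functional:
  assumes "affine_isometry w" "a \<noteq> 0"
  obtains a' b' where "a' \<noteq> 0" "\<And>v. a' \<bullet> w v - b' = a \<bullet> v - b"
proof -
  obtain f t where f: "orthogonal_transformation f" "linear f" "inj f" "w = (+) t \<circ> f"
    using affine_isometryE[OF assms(1)] by metis
  show thesis
  proof
    show "f a \<noteq> 0"
      using f assms(2) by (metis injD linear_0)
    show "f a \<bullet> w v - (b + f a \<bullet> t) = a \<bullet> v - b" for v
      using f by (simp add: inner_add_right orthogonal_transformation_def)
  qed
qed

lemma separatesI:
  assumes "a \<noteq> 0" "H = {v. a \<bullet> v = b}" "\<And>v. v \<in> C \<Longrightarrow> a \<bullet> v \<le> b" "\<And>v. v \<in> D \<Longrightarrow> a \<bullet> v \<ge> b"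
  shows "separates H C D"
  unfolding separates_def using assms by (intro exI[of _ a] exI[of _ b] conjI) auto

lemma separatesE:
  assumes "separates H C D"
  obtains a b where "a \<noteq> 0" "H = {v. a \<bullet> v = b}"
    "\<And>v. v \<in> C \<Longrightarrow> a \<bullet> v \<le> b" "\<And>v. v \<in> D \<Longrightarrow> a \<bullet> v \<ge> b"
proof -
  obtain a b where a: "a \<noteq> 0" "H = {v. a \<bullet> v = b}" and "C \<subseteq> {v. a \<bullet> v \<le> b}" "D \<subseteq> {v. a \<bullet> v \<ge> b}"
    using assms unfolding separates_def by (elim exE conjE)
  then have "a \<bullet> v \<le> b" if "v \<in> C" for v
    using that by auto
  moreover have "a \<bullet> v \<ge> b" if "v \<in> D" for v
    using that \<open>D \<subseteq> _\<close> by auto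
  ultimately show thesis
    using a by (intro that) blast+
qed

lemma separates_sym: "separates H C D \<Longrightarrow> separates H D C"
  by (elim separatesE, rule_tac a = "- a" and b = "- b" in separatesI) auto

lemma separates_affine_isometry:
  assumes w: "affine_isometry w" "bij w" and "separates H C D"
  shows "separates (w ` H) (w ` C) (w ` D)"
proof -
  obtain a b where a: "a \<noteq> 0" "H = {v. a \<bullet> v = b}"
    "\<And>v. v \<in> C \<Longrightarrow> a \<bullet> v \<le> b" "\<And>v. v \<in> D \<Longrightarrow> a \<bullet> v \<ge> b"
    using separatesE[OF assms(3)] by metis
  obtain a' b' where a': "a' \<noteq> 0" "\<And>v. a' \<bullet> w v - b' = a \<bullet> v - b"
    using affine_isometry_functional[OF w(1) a(1)] by metis
  have iff: "a' \<bullet> w v = b' \<longleftrightarrow> a \<bullet> v = b" "a' \<bullet> w v \<le> b' \<longleftrightarrow> a \<bullet> v \<le> b"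
    "b' \<le> a' \<bullet> w v \<longleftrightarrow> b \<le> a \<bullet> v" for v
    using a'(2)[of v] by auto
  have "w ` H = {v. a' \<bullet> v = b'}"
    using iff(1) surjD[OF bij_is_surj[OF w(2)]] unfolding a(2) by (auto simp: image_iff) metis
  with a'(1) show ?thesis
    by (rule separatesI) (auto simp: iff a)
qed

section \<open>Affine reflections\<close>

lemma affine_refl_eq_iff: "\<alpha> \<noteq> 0 \<Longrightarrow> affine_refl \<alpha> k v = v \<longleftrightarrow> \<alpha> \<bullet> v = k"
  by (auto simp: affine_refl_def coroot_def)

lemma affine_refl_functional: "\<alpha> \<noteq> 0 \<Longrightarrow> \<alpha> \<bullet> affine_refl \<alpha> k v - k = - (\<alpha> \<bullet> v - k)"
  by (simp add: affine_refl_def coroot_def inner_diff_right)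

lemma affine_refl_invol:
  assumes "\<alpha> \<noteq> 0"
  shows "affine_refl \<alpha> k (affine_refl \<alpha> k v) = v"
proof -
  have "affine_refl \<alpha> k (affine_refl \<alpha> k v) =
      affine_refl \<alpha> k v - (\<alpha> \<bullet> affine_refl \<alpha> k v - k) *\<^sub>R coroot \<alpha>"
    by (simp add: affine_refl_def)
  also have "\<dots> = v"
    unfolding affine_refl_functional[OF assms] by (simp add: affine_refl_def scaleR_diff_left)
  finally show ?thesis .
qed

lemma affine_refl_scaled:
  assumes "c \<noteq> 0"
  shows "affine_refl (c *\<^sub>R \<alpha>) (c * k) = affine_refl \<alpha> k"
  using assms by (cases "\<alpha> = 0") (auto simp: affine_refl_def coroot_def fun_eq_iff field_simps)

lemma affine_refl_cong_hyperplane: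
  assumes "\<alpha> \<noteq> 0" "\<beta> \<noteq> 0" "{v. \<alpha> \<bullet> v = k} = {v. \<beta> \<bullet> v = m}"
  shows "affine_refl \<alpha> k = affine_refl \<beta> m"
  using hyperplane_eq_imp_scaled[OF assms] affine_refl_scaled by metis

lemma affine_isometry_affine_refl:
  assumes "\<alpha> \<noteq> 0"
  shows "affine_isometry (affine_refl \<alpha> k)"
proof -
  have "linear (affine_refl \<alpha> 0)"
    by (intro linearI) (simp_all add: affine_refl_def inner_add_right scaleR_add_left algebra_simps)
  moreover have "affine_refl \<alpha> 0 u \<bullet> affine_refl \<alpha> 0 v = u \<bullet> v" for u v
    using assms
    by (simp add: affine_refl_def coroot_def inner_diff_left inner_diff_right inner_commute[of u \<alpha>])
  moreover have "affine_refl \<alpha> k = (\<lambda>v. k *\<^sub>R coroot \<alpha> + affine_refl \<alpha> 0 v)"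
    by (simp add: affine_refl_def fun_eq_iff scaleR_diff_left)
  ultimately show ?thesis
    unfolding affine_isometry_def orthogonal_transformation_def by blast
qed

lemma conj_affine_refl:
  assumes w: "affine_isometry w" "bij w" and "\<alpha> \<noteq> 0" "\<beta> \<noteq> 0"
    and H: "{v. \<beta> \<bullet> v = m} = w ` {v. \<alpha> \<bullet> v = k}"
  shows "affine_refl \<beta> m \<circ> w = w \<circ> affine_refl \<alpha> k"
proof -
  obtain f t where f: "orthogonal_transformation f" "linear f" "inj f" "w = (+) t \<circ> f"
    using affine_isometryE[OF w(1)] by metis
  have fa: "f \<alpha> \<noteq> 0"
    using f \<open>\<alpha> \<noteq> 0\<close> by (metis injD linear_0)
  have inner: "f u \<bullet> f v = u \<bullet> v" for u v
    using f(1) by (simp add: orthogonal_transformation_def)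
  have "w ` {v. \<alpha> \<bullet> v = k} = {v. f \<alpha> \<bullet> v = k + f \<alpha> \<bullet> t}"
  proof -
    have "f \<alpha> \<bullet> w v = k + f \<alpha> \<bullet> t \<longleftrightarrow> \<alpha> \<bullet> v = k" for v
      by (simp add: f inner_add_right inner)
    then show ?thesis
      using surjD[OF bij_is_surj[OF w(2)]] by (auto simp: image_iff) metis
  qed
  then have "affine_refl \<beta> m = affine_refl (f \<alpha>) (k + f \<alpha> \<bullet> t)"
    using affine_refl_cong_hyperplane[OF \<open>\<beta> \<noteq> 0\<close> fa] H by simp
  moreover have "affine_refl (f \<alpha>) (k + f \<alpha> \<bullet> t) (w v) = w (affine_refl \<alpha> k v)" for v
    using f(2) by (simp add: affine_refl_def coroot_def f(4) inner inner_add_right linear_diff linear_cmul)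
  ultimately show ?thesis
    by (simp add: fun_eq_iff)
qed

section \<open>Walls, alcoves and the affine Weyl group\<close>

lemma word_prod_simps [simp]: "word_prod [] = id" "word_prod (s # ws) = s \<circ> word_prod ws"
  by (simp_all add: word_prod_def)

lemma word_prod_append: "word_prod (us @ ws) = word_prod us \<circ> word_prod ws"
  by (induction us) (auto simp: comp_assoc)

locale affine_weyl =
  fixes \<Phi> \<Delta> :: "'a::euclidean_space set" and \<theta> :: 'a
  assumes irreducible: "irreducible_root_system \<Phi>"
    and simple: "simple_roots \<Phi> \<Delta>"
    and highest: "highest_root \<Phi> \<Delta> \<theta>"
begin

abbreviation "S \<equiv> simple_reflections \<Delta> \<theta>"
abbreviation "W \<equiv> affine_weyl_group \<Delta> \<theta>"
abbreviation "A\<^sub>0 \<equiv> fundamental_alcove \<Delta> \<theta>"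

lemma root_system: "root_system \<Phi>" and roots_nonempty: "\<Phi> \<noteq> {}"
  using irreducible by (simp_all add: irreducible_root_system_def)

lemma root_nonzero: "\<alpha> \<in> \<Phi> \<Longrightarrow> \<alpha> \<noteq> 0"
  and finite_roots: "finite \<Phi>"
  and refl_root: "\<alpha> \<in> \<Phi> \<Longrightarrow> \<beta> \<in> \<Phi> \<Longrightarrow> affine_refl \<alpha> 0 \<beta> \<in> \<Phi>"
  and crystallographic: "\<alpha> \<in> \<Phi> \<Longrightarrow> \<beta> \<in> \<Phi> \<Longrightarrow> \<alpha> \<bullet> coroot \<beta> \<in> \<int>"
  using root_system by (auto simp: root_system_def)

lemma simple_subset: "\<Delta> \<subseteq> \<Phi>"
  and independent_simple: "independent \<Delta>"
  using simple by (simp_all add: simple_roots_def)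

lemma highest_root_mem: "\<theta> \<in> \<Phi>"
  using highest by (simp add: highest_root_def)

lemma simple_reflection_cases:
  assumes "s \<in> S"
  obtains \<delta> m where "\<delta> \<in> \<Phi>" "s = affine_refl \<delta> (of_int m)"
    "\<delta> \<in> \<Delta> \<and> m = 0 \<or> \<delta> = \<theta> \<and> m = 1"
proof (cases "s = affine_refl \<theta> 1")
  case True
  then show thesis
    using that[of \<theta> 1] highest_root_mem by simp
next
  case False
  then obtain \<alpha> where "\<alpha> \<in> \<Delta>" "s = affine_refl \<alpha> 0"
    using assms unfolding simple_reflections_def by auto
  then show thesis
    using that[of \<alpha> 0] simple_subset by auto
qed

lemma simple_reflection_invol: "s \<in> S \<Longrightarrow> s \<circ> s = id"
  by (erule simple_reflection_cases) (auto simp: fun_eq_iff affine_refl_invol root_nonzero)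

lemma W_simple_reflection: "s \<in> S \<Longrightarrow> s \<in> W"
  unfolding affine_weyl_group_def by (rule image_eqI[of _ _ "[s]"]) auto

lemma W_comp:
  assumes "w \<in> W" "w' \<in> W"
  shows "w \<circ> w' \<in> W"
proof -
  obtain us ws where "us \<in> lists S" "w = word_prod us" "ws \<in> lists S" "w' = word_prod ws"
    using assms unfolding affine_weyl_group_def by blast
  then show ?thesis
    unfolding affine_weyl_group_def by (intro image_eqI[of _ _ "us @ ws"]) (auto simp: word_prod_append)
qed

lemma W_inverse:
  assumes "w \<in> W"
  obtains w' where "w' \<in> W" "w \<circ> w' = id" "w' \<circ> w = id"
proof -
  obtain ws where ws: "ws \<in> lists S" "w = word_prod ws"
    using assms unfolding affine_weyl_group_def by blast
  have inv: "word_prod ws \<circ> word_prod (rev ws) = id" if "ws \<in> lists S" for ws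
    using that
  proof (induction ws)
    case (Cons s ws)
    note s = Cons.hyps(1) and IH = Cons.IH
    have "word_prod (s # ws) \<circ> word_prod (rev (s # ws)) =
        s \<circ> (word_prod ws \<circ> word_prod (rev ws)) \<circ> s"
      by (simp add: word_prod_append comp_assoc)
    also have "\<dots> = id"
      by (simp only: IH comp_id simple_reflection_invol[OF s])
    finally show ?case .
  qed simp
  have rev: "rev ws \<in> lists S"
    using ws(1) by auto
  show thesis
  proof (rule that)
    show "word_prod (rev ws) \<in> W"
      using rev unfolding affine_weyl_group_def by (rule imageI)
    show "w \<circ> word_prod (rev ws) = id" "word_prod (rev ws) \<circ> w = id"
      using inv[OF ws(1)] inv[OF rev] unfolding ws(2) rev_rev_ident .
  qed
qed

lemma W_bij: "w \<in> W \<Longrightarrow> bij w"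
  by (metis W_inverse o_bij)

lemma W_induct [consumes 1, case_names id comp]:
  assumes "w \<in> W" "P id" "\<And>s w. s \<in> S \<Longrightarrow> w \<in> W \<Longrightarrow> P w \<Longrightarrow> P (s \<circ> w)"
  shows "P w"
proof -
  obtain ws where "ws \<in> lists S" "w = word_prod ws"
    using assms(1) unfolding affine_weyl_group_def by blast
  moreover have "P (word_prod ws)" if "ws \<in> lists S" for ws
    using that
  proof (induction ws)
    case Nil
    show ?case
      unfolding word_prod_simps by (rule assms(2))
  next
    case (Cons s ws)
    then have "s \<in> S" "ws \<in> lists S"
      by simp_all
    then show ?case
      unfolding word_prod_simps by (intro assms(3) Cons.IH) (auto simp: affine_weyl_group_def)
  qed
  ultimately show ?thesis by simp
qed

lemma simple_reflection_affine_isometry: "s \<in> S \<Longrightarrow> affine_isometry s"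
  by (elim simple_reflection_cases) (simp add: affine_isometry_affine_refl root_nonzero)

lemma W_affine_isometry: "w \<in> W \<Longrightarrow> affine_isometry w"
  by (induction rule: W_induct)
     (rule affine_isometry_id, rule affine_isometry_comp[OF simple_reflection_affine_isometry])

lemma wallE:
  assumes "M \<in> walls \<Phi>"
  obtains \<beta> j where "\<beta> \<in> \<Phi>" "\<beta> \<noteq> 0" "M = {v. \<beta> \<bullet> v = of_int j}"
  using assms root_nonzero unfolding walls_def hyperplane_def by auto

lemma affine_refl_wall:
  assumes "\<alpha> \<in> \<Phi>" "M \<in> walls \<Phi>"
  shows "affine_refl \<alpha> (of_int k) ` M \<in> walls \<Phi>"
proof -
  let ?r = "affine_refl \<alpha> (of_int k)"
  obtain \<beta> j where \<beta>: "\<beta> \<in> \<Phi>" "M = {v. \<beta> \<bullet> v = of_int j}"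
    using wallE[OF assms(2)] by metis
  obtain n where n: "\<beta> \<bullet> coroot \<alpha> = of_int n"
    using crystallographic[OF \<beta>(1) assms(1)] by (metis Ints_cases)
  have inv: "?r (?r v) = v" for v
    using affine_refl_invol root_nonzero assms(1) by blast
  have eq: "\<beta> \<bullet> ?r v = affine_refl \<alpha> 0 \<beta> \<bullet> v + of_int (k * n)" for v
  proof -
    have "\<beta> \<bullet> ?r v = \<beta> \<bullet> v - (\<alpha> \<bullet> v - of_int k) * of_int n"
      by (simp add: affine_refl_def inner_diff_right n)
    moreover have "affine_refl \<alpha> 0 \<beta> \<bullet> v = \<beta> \<bullet> v - (\<alpha> \<bullet> v) * of_int n"
      by (simp add: affine_refl_def coroot_def inner_diff_left n[symmetric] inner_commute[of \<beta> \<alpha>])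
    ultimately show ?thesis
      by (simp add: algebra_simps)
  qed
  have "?r ` M = {v. ?r v \<in> M}"
    using inv by (auto simp: image_iff) (metis inv)
  also have "\<dots> = hyperplane (affine_refl \<alpha> 0 \<beta>) (of_int (j - k * n))"
    unfolding \<beta>(2) hyperplane_def using eq by auto
  finally show ?thesis
    unfolding walls_def using refl_root[OF assms(1) \<beta>(1)] by blast
qed

lemma simple_reflection_wall: "s \<in> S \<Longrightarrow> M \<in> walls \<Phi> \<Longrightarrow> s ` M \<in> walls \<Phi>"
  by (elim simple_reflection_cases) (simp only: affine_refl_wall)

lemma W_wall: "w \<in> W \<Longrightarrow> M \<in> walls \<Phi> \<Longrightarrow> w ` M \<in> walls \<Phi>"
proof (induction rule: W_induct)
  case id
  then show ?case by simp
next
  case (comp s w)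
  show ?case
    unfolding image_comp[symmetric]
    using comp.hyps(1) comp.IH[OF comp.prems] by (rule simple_reflection_wall)
qed

lemma closed_Union_walls: "closed (\<Union> (walls \<Phi>))"
proof -
  have "\<Union> (walls \<Phi>) = (\<Union>\<beta>\<in>\<Phi>. (\<lambda>v. \<beta> \<bullet> v) -` \<int>)"
  proof (intro subset_antisym subsetI)
    fix v assume "v \<in> \<Union> (walls \<Phi>)"
    then obtain M where "M \<in> walls \<Phi>" "v \<in> M" ..
    then obtain \<beta> j where "\<beta> \<in> \<Phi>" "\<beta> \<bullet> v = of_int j"
      by (auto elim: wallE)
    then show "v \<in> (\<Union>\<beta>\<in>\<Phi>. (\<lambda>v. \<beta> \<bullet> v) -` \<int>)"
      by (intro UN_I[of \<beta>]) simp_all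
  next
    fix v assume "v \<in> (\<Union>\<beta>\<in>\<Phi>. (\<lambda>v. \<beta> \<bullet> v) -` \<int>)"
    then obtain \<beta> j where "\<beta> \<in> \<Phi>" "\<beta> \<bullet> v = of_int j"
      by (auto elim: Ints_cases)
    then show "v \<in> \<Union> (walls \<Phi>)"
      unfolding walls_def hyperplane_def by blast
  qed
  moreover have "closed ((\<lambda>v. \<beta> \<bullet> v) -` \<int>)" for \<beta> :: 'a
    by (intro closed_vimage closed_Ints continuous_on_inner continuous_on_const continuous_on_id)
  ultimately show ?thesis
    using finite_roots by auto
qed

lemma alcoveE:
  assumes "c \<in> alcoves \<Phi>"
  obtains K where "K \<in> components (- \<Union> (walls \<Phi>))" "c = closure K"
    "K \<noteq> {}" "open K" "connected K" "K \<subseteq> - \<Union> (walls \<Phi>)"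
proof -
  obtain K where K: "K \<in> components (- \<Union> (walls \<Phi>))" "c = closure K"
    using assms unfolding alcoves_def by (elim imageE)
  then show thesis
    by (intro that[OF K] in_components_nonempty[OF K(1)] in_components_connected[OF K(1)]
        in_components_subset[OF K(1)] open_components[OF _ K(1)] open_Compl closed_Union_walls)
qed

lemma alcove_interior:
  assumes "c \<in> alcoves \<Phi>"
  shows "interior c \<noteq> {}"
proof -
  obtain K where "c = closure K" "K \<noteq> {}" "open K"
    using alcoveE[OF assms] by metis
  then show ?thesis
    by (metis bot.extremum_uniqueI closure_subset interior_maximal)
qed

lemma alcove_not_subset_hyperplane:
  assumes "c \<in> alcoves \<Phi>" "a \<noteq> 0"
  obtains v where "v \<in> c" "a \<bullet> v \<noteq> b"
  using alcove_interior[OF assms(1)] interior_hyperplane[OF assms(2), of b]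
    interior_mono[of c "{v. a \<bullet> v = b}"] by blast

lemma alcove_one_side:
  assumes "c \<in> alcoves \<Phi>" "{v. a \<bullet> v = b} \<in> walls \<Phi>"
  shows "c \<subseteq> {v. a \<bullet> v \<le> b} \<or> c \<subseteq> {v. a \<bullet> v \<ge> b}"
proof -
  obtain K where K: "c = closure K" "connected K" "K \<subseteq> - \<Union> (walls \<Phi>)"
    using alcoveE[OF assms(1)] by metis
  have "K \<subseteq> {v. a \<bullet> v \<le> b} \<or> K \<subseteq> {v. a \<bullet> v \<ge> b}"
  proof (rule ccontr)
    assume "\<not> ?thesis"
    then obtain x y where "x \<in> K" "y \<in> K" "a \<bullet> x < b" "b < a \<bullet> y"
      by (auto simp: not_le subset_iff)
    then obtain z where "z \<in> K" "a \<bullet> z = b"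
      using connected_ivt_hyperplane[OF K(2)] less_imp_le by metis
    then show False
      using K(3) assms(2) by blast
  qed
  moreover have "closed {v. a \<bullet> v \<le> b}" "closed {v. a \<bullet> v \<ge> b}"
    by (simp_all add: closed_halfspace_le closed_halfspace_ge)
  ultimately show ?thesis
    unfolding K(1) by (meson closure_minimal)
qed

lemma alcove_boundary_subset:
  assumes "c \<in> alcoves \<Phi>" "x \<in> c" "x \<notin> interior c"
  shows "x \<in> \<Union> (walls \<Phi>)"
proof (rule ccontr)
  assume x: "x \<notin> \<Union> (walls \<Phi>)"
  obtain K where K: "K \<in> components (- \<Union> (walls \<Phi>))" "c = closure K" "open K"
    using alcoveE[OF assms(1)] by metis
  let ?K' = "connected_component_set (- \<Union> (walls \<Phi>)) x"
  have K': "?K' \<in> components (- \<Union> (walls \<Phi>))" "x \<in> ?K'"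
    using x by (auto simp: components_def)
  moreover have "open ?K'"
    using K' closed_Union_walls open_Compl open_components by blast
  ultimately have "?K' \<inter> K \<noteq> {}"
    using assms(2) K(2) open_Int_closure_eq_empty[of ?K' K] by blast
  then have "?K' = K"
    using K' K components_nonoverlap by blast
  then have "x \<in> interior c"
    using K K'(2) by (metis closure_subset interior_maximal subsetD)
  then show False
    using assms(3) by blast
qed

lemma alcove_facet_wall:
  assumes c: "c \<in> alcoves \<Phi>" and F: "F facet_of c"
  shows "affine hull F \<in> walls \<Phi>"
proof -
  have face: "F \<subseteq> c" "convex F" "F \<noteq> {}"
    "\<And>u v x. u \<in> c \<Longrightarrow> v \<in> c \<Longrightarrow> x \<in> F \<Longrightarrow> x \<in> open_segment u v \<Longrightarrow> u \<in> F \<and> v \<in> F"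
    using F unfolding facet_of_def face_of_def by blast+
  have dim: "aff_dim F = DIM('a) - 1"
    using F aff_dim_nonempty_interior[OF alcove_interior[OF c]] by (simp add: facet_of_def)
  obtain x where x: "x \<in> rel_interior F"
    using rel_interior_eq_empty[OF face(2)] face(3) by blast
  then have xF: "x \<in> F"
    using rel_interior_subset by blast
  have "x \<notin> interior c"
  proof
    assume "x \<in> interior c"
    then obtain \<epsilon> where \<epsilon>: "\<epsilon> > 0" "ball x \<epsilon> \<subseteq> c"
      by (meson mem_interior)
    have "ball x \<epsilon> \<subseteq> F"
    proof
      fix u assume u: "u \<in> ball x \<epsilon>"
      define v where "v = x - (u - x)"
      have "dist x v = dist x u"
        by (simp add: v_def dist_norm norm_minus_commute)
      then have "v \<in> c" "u \<in> c"
        using u \<epsilon>(2) by auto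
      moreover have "x = midpoint u v"
        by (simp add: v_def midpoint_def)
      ultimately show "u \<in> F"
        using face(4)[of u v x] xF by (metis midpoint_in_open_segment midpoint_idem)
    qed
    then have "interior F \<noteq> {}"
      using \<epsilon>(1) by (metis centre_in_ball empty_iff mem_interior)
    then show False
      using dim aff_dim_nonempty_interior by fastforce
  qed
  then obtain M where M: "M \<in> walls \<Phi>" "x \<in> M"
    using alcove_boundary_subset[OF c] xF face(1) by blast
  obtain \<beta> j where \<beta>: "\<beta> \<noteq> 0" "M = {v. \<beta> \<bullet> v = j}"
    using wallE[OF M(1)] by metis
  have side: "c \<subseteq> {v. \<beta> \<bullet> v \<le> j} \<or> c \<subseteq> {v. \<beta> \<bullet> v \<ge> j}"
    using alcove_one_side[OF c] M(1) \<beta>(2) by blast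
  \<comment> \<open>A linear functional attaining an extremum over a convex set at a relative interior point is constant.\<close>
  have "F \<subseteq> M"
  proof
    fix u assume u: "u \<in> F"
    obtain e where e: "e > 1" "(1 - e) *\<^sub>R u + e *\<^sub>R x \<in> F"
      using bspec[OF convex_rel_interior_if[OF face(2) x] hull_inc[OF u]] by auto
    have "(1 - e) *\<^sub>R u + e *\<^sub>R x \<in> c" "u \<in> c" "\<beta> \<bullet> x = j"
      using e(2) u face(1) M(2) \<beta>(2) by auto
    moreover have "\<beta> \<bullet> ((1 - e) *\<^sub>R u + e *\<^sub>R x) = \<beta> \<bullet> x - (e - 1) * (\<beta> \<bullet> u - \<beta> \<bullet> x)"
      by (simp add: inner_simps algebra_simps)
    ultimately have "(e - 1) * (\<beta> \<bullet> u - j) = 0"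
      using side e(1) by (smt (verit) mem_Collect_eq subsetD mult_nonneg_nonneg mult_nonneg_nonpos)
    then show "u \<in> M"
      using e(1) \<beta>(2) by simp
  qed
  then have "affine hull F \<subseteq> M"
    unfolding \<beta>(2) by (intro hull_minimal) (auto simp: affine_hyperplane)
  moreover have "aff_dim (affine hull F) = aff_dim M"
    using dim \<beta> by simp
  ultimately have "affine hull F = M"
    using face(3) unfolding \<beta>(2)
    by (intro affine_dim_equal) (auto simp: affine_hyperplane)
  then show ?thesis
    using M(1) by simp
qed

lemma W_alcove:
  assumes w: "w \<in> W" and c: "c \<in> alcoves \<Phi>"
  shows "w ` c \<in> alcoves \<Phi>"
proof -
  let ?U = "- \<Union> (walls \<Phi>)"
  have complement: "x ` K \<subseteq> ?U" if x: "x \<in> W" and K: "K \<subseteq> ?U" for x K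
  proof -
    obtain x' where x': "x' \<in> W" "x' \<circ> x = id"
      using W_inverse[OF x] by metis
    have "v \<in> \<Union> (walls \<Phi>)" if "x v \<in> M" "M \<in> walls \<Phi>" for v M
    proof -
      have "v \<in> x' ` M"
        using that x'(2) by (metis comp_apply id_apply image_eqI)
      then show ?thesis
        using W_wall[OF x'(1) that(2)] by blast
    qed
    then show ?thesis
      using K by blast
  qed
  obtain w' where w': "w' \<in> W" "w \<circ> w' = id" "w' \<circ> w = id"
    using W_inverse[OF w] by metis
  have im: "w' ` w ` X = X" "w ` w' ` X = X" for X
    using w'(2,3) by (simp_all add: image_comp)
  obtain K where K: "K \<in> components ?U" "c = closure K"
    using alcoveE[OF c] by metis
  have "w ` K \<in> components ?U"
    unfolding in_components_maximal
  proof (intro conjI allI impI)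
    show "w ` K \<noteq> {}" "w ` K \<subseteq> ?U"
      using complement[OF w in_components_subset[OF K(1)]] in_components_nonempty[OF K(1)] by simp_all
    show "connected (w ` K)"
      using K(1) by (intro connected_continuous_image affine_isometry_continuous_on W_affine_isometry w)
        (auto dest: in_components_connected)
    fix D assume D: "D \<noteq> {} \<and> w ` K \<subseteq> D \<and> D \<subseteq> ?U \<and> connected D"
    have "connected (w' ` D)"
      using D by (intro connected_continuous_image affine_isometry_continuous_on W_affine_isometry w') auto
    moreover have "w' ` w ` K \<subseteq> w' ` D" "w' ` D \<subseteq> ?U" "w' ` D \<noteq> {}"
      using D complement[OF w'(1)] by (simp_all add: image_mono)
    ultimately have "w' ` D = K"
      using K(1) unfolding im(1) in_components_maximal by simp
    then show "D = w ` K"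
      using im(2) by metis
  qed
  then show ?thesis
    unfolding alcoves_def K(2) using closure_affine_isometry[OF W_affine_isometry[OF w]] by blast
qed

section \<open>The fundamental alcove\<close>

lemma simple_dual:
  obtains x where "\<And>\<alpha>. \<alpha> \<in> \<Delta> \<Longrightarrow> \<alpha> \<bullet> x = g \<alpha>"
proof -
  obtain f :: "'a \<Rightarrow> real" where f: "linear f" "\<forall>\<alpha>\<in>\<Delta>. f \<alpha> = g \<alpha>"
    using linear_independent_extend[OF independent_simple] by blast
  show thesis
    using that[of "adjoint f 1"] f(2) adjoint_works[OF f(1), of _ 1] by simp
qed

lemma finite_simple: "finite \<Delta>"
  using finite_subset[OF simple_subset finite_roots] .

lemma nonneg_combination_inner_nonneg:
  assumes "v \<in> nonneg_combinations \<Delta>" "\<And>\<alpha>. \<alpha> \<in> \<Delta> \<Longrightarrow> 0 \<le> \<alpha> \<bullet> x"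
  shows "0 \<le> v \<bullet> x"
proof -
  obtain c :: "'a \<Rightarrow> nat" where "v = (\<Sum>\<alpha>\<in>\<Delta>. real (c \<alpha>) *\<^sub>R \<alpha>)"
    using assms(1) by (auto simp: nonneg_combinations_def)
  then show ?thesis
    using assms(2) by (simp add: inner_sum_left sum_nonneg)
qed

lemma nonneg_combination_inner_pos:
  assumes "v \<in> nonneg_combinations \<Delta>" "v \<noteq> 0" "\<And>\<alpha>. \<alpha> \<in> \<Delta> \<Longrightarrow> 0 < \<alpha> \<bullet> x"
  shows "0 < v \<bullet> x"
proof -
  obtain c :: "'a \<Rightarrow> nat" where c: "v = (\<Sum>\<alpha>\<in>\<Delta>. real (c \<alpha>) *\<^sub>R \<alpha>)"
    using assms(1) by (auto simp: nonneg_combinations_def)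
  have "\<exists>\<alpha>\<in>\<Delta>. c \<alpha> \<noteq> 0"
  proof (rule ccontr)
    assume "\<not> ?thesis"
    then have "v = 0"
      by (simp add: c)
    then show False
      using assms(2) by simp
  qed
  then obtain \<alpha> where \<alpha>: "\<alpha> \<in> \<Delta>" "c \<alpha> \<noteq> 0"
    by blast
  have "0 < (\<Sum>\<alpha>\<in>\<Delta>. real (c \<alpha>) * (\<alpha> \<bullet> x))"
    using assms(3) \<alpha> by (intro sum_pos2[OF finite_simple \<alpha>(1)]) (auto simp: less_imp_le)
  then show ?thesis
    by (simp add: c inner_sum_left)
qed

lemma root_sign: "\<beta> \<in> \<Phi> \<Longrightarrow> \<beta> \<in> nonneg_combinations \<Delta> \<or> - \<beta> \<in> nonneg_combinations \<Delta>"
  using simple by (auto simp: simple_roots_def positive_roots_def)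

lemma uminus_root:
  assumes "\<beta> \<in> \<Phi>"
  shows "- \<beta> \<in> \<Phi>"
proof -
  have "affine_refl \<beta> 0 \<beta> = - \<beta>"
    using root_nonzero[OF assms] by (simp add: affine_refl_def coroot_def scaleR_2)
  then show ?thesis
    using refl_root[OF assms assms] by simp
qed

lemma root_le_highest:
  assumes "\<beta> \<in> \<Phi>" "\<And>\<alpha>. \<alpha> \<in> \<Delta> \<Longrightarrow> 0 \<le> \<alpha> \<bullet> x"
  shows "\<beta> \<bullet> x \<le> \<theta> \<bullet> x"
proof -
  have "\<theta> - \<beta> \<in> nonneg_combinations \<Delta>"
    using highest assms(1) by (simp add: highest_root_def)
  then have "0 \<le> (\<theta> - \<beta>) \<bullet> x"
    by (rule nonneg_combination_inner_nonneg) (rule assms(2))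
  then show ?thesis
    by (simp add: inner_diff_left)
qed

lemma simple_nonempty: "\<Delta> \<noteq> {}"
proof
  assume "\<Delta> = {}"
  then have "nonneg_combinations \<Delta> = {0}"
    by (auto simp: nonneg_combinations_def)
  moreover obtain \<beta> where "\<beta> \<in> \<Phi>"
    using roots_nonempty by blast
  ultimately show False
    using root_sign[of \<beta>] root_nonzero[of \<beta>] by simp
qed

lemma highest_root_pos:
  assumes "\<And>\<alpha>. \<alpha> \<in> \<Delta> \<Longrightarrow> 0 < \<alpha> \<bullet> x"
  shows "0 < \<theta> \<bullet> x"
proof -
  obtain \<alpha> where "\<alpha> \<in> \<Delta>"
    using simple_nonempty by blast
  then show ?thesis
    using root_le_highest[of \<alpha> x] simple_subset assms less_imp_le by (meson less_le_trans subsetD)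
qed

lemma highest_root_nonneg:
  assumes "\<And>\<alpha>. \<alpha> \<in> \<Delta> \<Longrightarrow> 0 \<le> \<alpha> \<bullet> x"
  shows "0 \<le> \<theta> \<bullet> x"
proof -
  obtain \<alpha> where "\<alpha> \<in> \<Delta>"
    using simple_nonempty by blast
  then show ?thesis
    using root_le_highest[of \<alpha> x] simple_subset assms by (meson order_trans subsetD)
qed

definition open_alcove :: "'a set" where
  "open_alcove = {v. (\<forall>\<alpha>\<in>\<Delta>. 0 < \<alpha> \<bullet> v) \<and> \<theta> \<bullet> v < 1}"

lemma open_alcove_nonempty: "open_alcove \<noteq> {}"
proof -
  obtain x where x: "\<And>\<alpha>. \<alpha> \<in> \<Delta> \<Longrightarrow> \<alpha> \<bullet> x = 1"
    using simple_dual[of "\<lambda>_. 1"] by metis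
  have \<theta>: "0 < \<theta> \<bullet> x"
    using x by (intro highest_root_pos) simp
  then have "(1 / (1 + \<theta> \<bullet> x)) *\<^sub>R x \<in> open_alcove"
    using x by (simp add: open_alcove_def)
  then show ?thesis by blast
qed

lemma convex_open_alcove: "convex open_alcove"
proof -
  have "open_alcove = (\<Inter>\<alpha>\<in>\<Delta>. {v. \<alpha> \<bullet> v > 0}) \<inter> {v. \<theta> \<bullet> v < 1}"
    by (auto simp: open_alcove_def)
  then show ?thesis
    by (simp add: convex_INT convex_Int convex_halfspace_gt convex_halfspace_lt)
qed

lemma closure_open_alcove: "closure open_alcove = A\<^sub>0"
proof (intro subset_antisym subsetI)
  have "A\<^sub>0 = (\<Inter>\<alpha>\<in>\<Delta>. {v. \<alpha> \<bullet> v \<ge> 0}) \<inter> {v. \<theta> \<bullet> v \<le> 1}"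
    by (auto simp: fundamental_alcove_def)
  then have "closed A\<^sub>0"
    by (simp add: closed_INT closed_Int closed_halfspace_ge closed_halfspace_le)
  moreover have "open_alcove \<subseteq> A\<^sub>0"
    by (auto simp: open_alcove_def fundamental_alcove_def less_imp_le)
  ultimately show "v \<in> A\<^sub>0" if "v \<in> closure open_alcove" for v
    using closure_minimal that by blast
next
  fix v assume v: "v \<in> A\<^sub>0"
  obtain x where x: "x \<in> open_alcove"
    using open_alcove_nonempty by blast
  define z where "z n = v + inverse (real (Suc n)) *\<^sub>R (x - v)" for n
  have mem: "v + t *\<^sub>R (x - v) \<in> open_alcove" if t: "0 < t" "t \<le> 1" for t
  proof -
    have eq: "u \<bullet> (v + t *\<^sub>R (x - v)) = (1 - t) * (u \<bullet> v) + t * (u \<bullet> x)" for u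
      by (simp add: inner_add_right inner_diff_right algebra_simps)
    have "0 < (1 - t) * (\<alpha> \<bullet> v) + t * (\<alpha> \<bullet> x)" if "\<alpha> \<in> \<Delta>" for \<alpha>
      using that v x t by (intro add_nonneg_pos) (auto simp: open_alcove_def fundamental_alcove_def)
    moreover have "(1 - t) * (\<theta> \<bullet> v) + t * (\<theta> \<bullet> x) < (1 - t) * 1 + t * 1"
      using v x t by (intro add_le_less_mono mult_left_mono mult_strict_left_mono)
        (auto simp: open_alcove_def fundamental_alcove_def)
    ultimately show ?thesis
      unfolding open_alcove_def by (simp add: eq)
  qed
  have "z n \<in> open_alcove" for n
    unfolding z_def by (rule mem) (simp_all add: field_simps)
  moreover have "z \<longlonglongrightarrow> v + 0 *\<^sub>R (x - v)"
    unfolding z_def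
    by (intro tendsto_add tendsto_const tendsto_scaleR LIMSEQ_inverse_real_of_nat)
  ultimately show "v \<in> closure open_alcove"
    unfolding closure_sequential by (intro exI[of _ z]) simp
qed

lemma fundamental_alcove_alcove: "A\<^sub>0 \<in> alcoves \<Phi>"
proof -
  let ?U = "- \<Union> (walls \<Phi>)"
  have U: "open_alcove \<subseteq> ?U"
  proof
    fix x assume "x \<in> open_alcove"
    then have x: "\<And>\<alpha>. \<alpha> \<in> \<Delta> \<Longrightarrow> 0 < \<alpha> \<bullet> x" "\<theta> \<bullet> x < 1"
      by (auto simp: open_alcove_def)
    have lt: "\<beta> \<bullet> x < 1" if "\<beta> \<in> \<Phi>" for \<beta>
      using root_le_highest[OF that, of x] x by (meson le_less_trans less_imp_le)
    have "x \<notin> M" if M: "M \<in> walls \<Phi>" for M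
    proof
      assume "x \<in> M"
      obtain \<beta> j where \<beta>': "\<beta> \<in> \<Phi>" "\<beta> \<noteq> 0" "M = {v. \<beta> \<bullet> v = of_int j}"
        using wallE[OF M] by metis
      with \<open>x \<in> M\<close> have \<beta>: "\<beta> \<in> \<Phi>" "\<beta> \<noteq> 0" "\<beta> \<bullet> x = of_int j"
        by simp_all
      have "0 < \<beta> \<bullet> x \<or> 0 < (- \<beta>) \<bullet> x"
        using root_sign[OF \<beta>(1)] nonneg_combination_inner_pos[of _ x] x(1) \<beta>(2)
        by (metis neg_equal_0_iff_equal)
      then have "0 < j \<and> j < 1 \<or> 0 < - j \<and> - j < 1"
        using \<beta>(3) lt[OF \<beta>(1)] lt[OF uminus_root[OF \<beta>(1)]] by auto
      then show False by linarith
    qed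
    then show "x \<in> ?U" by blast
  qed
  have "open_alcove \<in> components ?U"
    unfolding in_components_maximal
  proof (intro conjI allI impI)
    fix D assume D: "D \<noteq> {} \<and> open_alcove \<subseteq> D \<and> D \<subseteq> ?U \<and> connected D"
    obtain x where x: "x \<in> open_alcove"
      using open_alcove_nonempty by blast
    have D': "connected D" "x \<in> D"
      using D x by blast+
    have no_wall: "\<beta> \<bullet> v \<noteq> of_int j" if "v \<in> D" "\<beta> \<in> \<Phi>" for v \<beta> j
    proof -
      have "hyperplane \<beta> (of_int j) \<in> walls \<Phi>"
        using that(2) unfolding walls_def by (intro CollectI exI[of _ \<beta>] exI[of _ j] conjI refl)
      then have "v \<notin> hyperplane \<beta> (of_int j)"
        using D that(1) by blast
      then show ?thesis
        by (simp add: hyperplane_def)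
    qed
    have "v \<in> open_alcove" if "v \<in> D" for v
    proof -
      have "0 < \<alpha> \<bullet> v" if "\<alpha> \<in> \<Delta>" for \<alpha>
      proof (rule ccontr)
        assume "\<not> ?thesis"
        moreover have "0 \<le> \<alpha> \<bullet> x"
          using x that by (simp add: open_alcove_def less_imp_le)
        ultimately obtain z where "z \<in> D" "\<alpha> \<bullet> z = 0"
          using connected_ivt_hyperplane[OF D'(1) \<open>v \<in> D\<close> D'(2), of \<alpha> 0] by auto
        then show False
          using no_wall[of z \<alpha> 0] that simple_subset by auto
      qed
      moreover have "\<theta> \<bullet> v < 1"
      proof (rule ccontr)
        assume "\<not> ?thesis"
        moreover have "\<theta> \<bullet> x \<le> 1"
          using x by (simp add: open_alcove_def)
        ultimately obtain z where "z \<in> D" "\<theta> \<bullet> z = 1"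
          using connected_ivt_hyperplane[OF D'(1,2) \<open>v \<in> D\<close>, of \<theta> 1] by auto
        then show False
          using no_wall[of z \<theta> 1] highest_root_mem by simp
      qed
      ultimately show ?thesis
        by (simp add: open_alcove_def)
    qed
    then show "D = open_alcove"
      using D by blast
  qed (use U open_alcove_nonempty convex_connected[OF convex_open_alcove] in auto)
  then show ?thesis
    unfolding alcoves_def using closure_open_alcove by (metis image_eqI)
qed

lemma W_fundamental_alcove: "w \<in> W \<Longrightarrow> w ` A\<^sub>0 \<in> alcoves \<Phi>"
  using W_alcove fundamental_alcove_alcove by blast

lemma origin_fundamental_alcove: "0 \<in> A\<^sub>0"
  by (simp add: fundamental_alcove_def)

lemma panel_point:
  assumes "s \<in> S"
  obtains \<delta> m U x where "\<delta> \<in> \<Phi>" "s = affine_refl \<delta> m" "open U" "x \<in> U" "\<delta> \<bullet> x = m"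
    "\<And>v. v \<in> U \<Longrightarrow> \<delta> \<bullet> v = m \<Longrightarrow> v \<in> A\<^sub>0"
proof (cases "s = affine_refl \<theta> 1")
  case True
  obtain x where x: "\<And>\<alpha>. \<alpha> \<in> \<Delta> \<Longrightarrow> \<alpha> \<bullet> x = 1"
    using simple_dual[of "\<lambda>_. 1"] by metis
  have \<theta>: "0 < \<theta> \<bullet> x"
    using x by (intro highest_root_pos) simp
  let ?U = "\<Inter>\<alpha>\<in>\<Delta>. {v. \<alpha> \<bullet> v > 0}"
  show thesis
  proof (rule that[of \<theta> 1 ?U "(1 / (\<theta> \<bullet> x)) *\<^sub>R x"])
    show "open ?U"
      using finite_simple by (intro open_INT) (auto simp: open_halfspace_gt)
  qed (use True highest_root_mem \<theta> x in \<open>auto simp: fundamental_alcove_def less_imp_le\<close>)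
next
  case False
  then obtain \<delta> where \<delta>: "\<delta> \<in> \<Delta>" "s = affine_refl \<delta> 0"
    using assms by (auto simp: simple_reflections_def)
  obtain x where x: "\<And>\<alpha>. \<alpha> \<in> \<Delta> \<Longrightarrow> \<alpha> \<bullet> x = (if \<alpha> = \<delta> then 0 else 1)"
    using simple_dual[of "\<lambda>\<alpha>. if \<alpha> = \<delta> then 0 else 1"] by metis
  have \<theta>: "0 \<le> \<theta> \<bullet> x"
    using x by (intro highest_root_nonneg) simp
  let ?U = "(\<Inter>\<alpha>\<in>\<Delta> - {\<delta>}. {v. \<alpha> \<bullet> v > 0}) \<inter> {v. \<theta> \<bullet> v < 1}"
  show thesis
  proof (rule that[of \<delta> 0 ?U "(1 / (1 + \<theta> \<bullet> x)) *\<^sub>R x"])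
    show "open ?U"
      using finite_simple by (intro open_Int open_INT) (auto simp: open_halfspace_gt open_halfspace_lt)
    show "v \<in> A\<^sub>0" if "v \<in> ?U" "\<delta> \<bullet> v = 0" for v
      using that unfolding fundamental_alcove_def by (auto intro: less_imp_le)
    show "(1 / (1 + \<theta> \<bullet> x)) *\<^sub>R x \<in> ?U"
      using x \<theta> by auto
  qed (use \<delta> x simple_subset in auto)
qed

lemma separates_fundamental:
  assumes s: "s \<in> S" and sep: "separates M A\<^sub>0 (s ` A\<^sub>0)"
  shows "M = {v. s v = v}"
proof -
  obtain \<delta> m U x where \<delta>: "\<delta> \<in> \<Phi>" "s = affine_refl \<delta> m" and U: "open U" "x \<in> U" "\<delta> \<bullet> x = m"
    "\<And>v. v \<in> U \<Longrightarrow> \<delta> \<bullet> v = m \<Longrightarrow> v \<in> A\<^sub>0"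
    using panel_point[OF s] by metis
  have \<delta>0: "\<delta> \<noteq> 0"
    using root_nonzero[OF \<delta>(1)] .
  obtain a b where a: "a \<noteq> 0" "M = {v. a \<bullet> v = b}"
    "\<And>v. v \<in> A\<^sub>0 \<Longrightarrow> a \<bullet> v \<le> b" "\<And>v. v \<in> s ` A\<^sub>0 \<Longrightarrow> a \<bullet> v \<ge> b"
    using separatesE[OF sep] by metis
  have fixed: "s v = v \<longleftrightarrow> \<delta> \<bullet> v = m" for v
    unfolding \<delta>(2) using affine_refl_eq_iff[OF \<delta>0] .
  have panel: "a \<bullet> v = b" if "v \<in> U" "\<delta> \<bullet> v = m" for v
  proof -
    have "v \<in> A\<^sub>0" "v \<in> s ` A\<^sub>0"
      using U(4)[OF that] fixed[of v] that(2) by (auto intro: image_eqI[of _ _ v])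
    then show ?thesis
      using a(3)[of v] a(4)[of v] by linarith
  qed
  obtain r where r: "r > 0" "ball x r \<subseteq> U"
    using U(1,2) openE by blast
  define c where "c = (\<delta> \<bullet> a) / (\<delta> \<bullet> \<delta>)"
  define u where "u = a - c *\<^sub>R \<delta>"
  have u: "\<delta> \<bullet> u = 0"
    using \<delta>0 by (simp add: u_def c_def inner_diff_right)
  define e where "e = r / (norm u + 1)"
  have e: "e > 0" "e * norm u < r"
  proof -
    show "e > 0"
      using r(1) by (simp add: e_def add_nonneg_pos)
    show "e * norm u < r"
      using r(1) by (simp add: e_def pos_divide_less_eq add_nonneg_pos)
  qed
  have "x + e *\<^sub>R u \<in> U"
    using r(2) e by (auto simp: dist_norm)
  then have "a \<bullet> (x + e *\<^sub>R u) = b"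
    by (rule panel) (simp add: inner_add_right u U(3))
  moreover have "a \<bullet> x = b"
    using panel U(2,3) .
  ultimately have "a \<bullet> u = 0"
    using e(1) by (simp add: inner_add_right)
  then have "u \<bullet> u = 0"
    using u by (simp add: u_def inner_diff_left)
  then have ac: "a = c *\<^sub>R \<delta>"
    by (simp add: u_def)
  moreover from ac have "c \<noteq> 0" "b = c * m"
    using a(1) \<open>a \<bullet> x = b\<close> U(3) by auto
  ultimately show ?thesis
    unfolding a(2) fixed by simp
qed

lemma separates_adjacent:
  assumes x: "x \<in> W" and s: "s \<in> S" and sep: "separates M (x ` A\<^sub>0) ((x \<circ> s) ` A\<^sub>0)"
  shows "M = x ` {v. s v = v}"
proof -
  obtain x' where x': "x' \<in> W" "x \<circ> x' = id" "x' \<circ> x = id"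
    using W_inverse[OF x] by metis
  have im: "x' ` x ` X = X" "x ` x' ` X = X" for X
    unfolding image_comp x' by simp_all
  have "separates (x' ` M) (x' ` x ` A\<^sub>0) (x' ` x ` s ` A\<^sub>0)"
    using separates_affine_isometry[OF W_affine_isometry[OF x'(1)] W_bij[OF x'(1)] sep]
    by (simp only: image_comp[symmetric])
  then have "x' ` M = {v. s v = v}"
    unfolding im by (rule separates_fundamental[OF s])
  then show ?thesis
    using im(2) by metis
qed

lemma separates_adjacent_refl:
  assumes x: "x \<in> W" and s: "s \<in> S" and sep: "separates {v. \<beta> \<bullet> v = j} (x ` A\<^sub>0) ((x \<circ> s) ` A\<^sub>0)"
    and \<beta>: "\<beta> \<noteq> 0"
  shows "affine_refl \<beta> j \<circ> x = x \<circ> s"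
proof -
  obtain \<delta> m where \<delta>: "\<delta> \<in> \<Phi>" "s = affine_refl \<delta> (of_int m)"
    using simple_reflection_cases[OF s] by metis
  have "{v. \<beta> \<bullet> v = j} = x ` {v. \<delta> \<bullet> v = of_int m}"
    using separates_adjacent[OF x s sep] affine_refl_eq_iff[OF root_nonzero[OF \<delta>(1)]]
    unfolding \<delta>(2) by simp
  then show ?thesis
    unfolding \<delta>(2)
    by (rule conj_affine_refl[OF W_affine_isometry[OF x] W_bij[OF x] root_nonzero[OF \<delta>(1)] \<beta>])
qed

lemma gallery_crossing:
  assumes wall: "{v. a \<bullet> v = b} \<in> walls \<Phi>" and a: "a \<noteq> 0"
    and "ws \<in> lists S" "u \<in> W" "u ` A\<^sub>0 \<subseteq> {v. a \<bullet> v \<ge> b}" "(u \<circ> word_prod ws) ` A\<^sub>0 \<subseteq> {v. a \<bullet> v \<le> b}"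
  shows "\<exists>us t vs. ws = us @ t # vs \<and> t \<in> S \<and> us \<in> lists S \<and> vs \<in> lists S \<and>
    affine_refl a b \<circ> (u \<circ> word_prod us) = u \<circ> word_prod us \<circ> t"
  using assms(3-)
proof (induction ws arbitrary: u rule: list.induct)
  case Nil
  obtain v where "v \<in> u ` A\<^sub>0" "a \<bullet> v \<noteq> b"
    using alcove_not_subset_hyperplane[OF W_fundamental_alcove[OF Nil(2)] a] by metis
  moreover have "u ` A\<^sub>0 \<subseteq> {v. a \<bullet> v \<le> b}"
    using Nil(4) by (simp only: word_prod_simps comp_id)
  ultimately show ?case
    using Nil(3) by force
next
  case (Cons t ws)
  have t: "t \<in> S" "ws \<in> lists S"
    using Cons.prems(1) by simp_all
  have ut: "u \<circ> t \<in> W"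
    using W_comp[OF Cons.prems(2) W_simple_reflection[OF t(1)]] .
  consider "(u \<circ> t) ` A\<^sub>0 \<subseteq> {v. a \<bullet> v \<le> b}" | "(u \<circ> t) ` A\<^sub>0 \<subseteq> {v. a \<bullet> v \<ge> b}"
    using alcove_one_side[OF W_fundamental_alcove[OF ut] wall] by blast
  then show ?case
  proof cases
    case 1
    have "separates {v. a \<bullet> v = b} ((u \<circ> t) ` A\<^sub>0) (u ` A\<^sub>0)"
    proof (rule separatesI[OF a refl])
      show "a \<bullet> v \<le> b" if "v \<in> (u \<circ> t) ` A\<^sub>0" for v
        using subsetD[OF 1 that] by simp
      show "a \<bullet> v \<ge> b" if "v \<in> u ` A\<^sub>0" for v
        using subsetD[OF Cons.prems(3) that] by simp
    qed
    then have "affine_refl a b \<circ> u = u \<circ> t"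
      by (rule separates_adjacent_refl[OF Cons.prems(2) t(1) separates_sym a])
    then show ?thesis
      using t by (intro exI[of _ "[]"] exI[of _ t] exI[of _ ws]) (simp only: word_prod_simps comp_id, simp)
  next
    case 2
    have "(u \<circ> t \<circ> word_prod ws) ` A\<^sub>0 \<subseteq> {v. a \<bullet> v \<le> b}"
      using Cons.prems(4) by (simp only: word_prod_simps comp_assoc)
    then obtain us t' vs where "ws = us @ t' # vs" "t' \<in> S" "us \<in> lists S" "vs \<in> lists S"
      "affine_refl a b \<circ> (u \<circ> t \<circ> word_prod us) = u \<circ> t \<circ> word_prod us \<circ> t'"
      using Cons.IH[OF t(2) ut 2] by blast
    then show ?thesis
      using t(1)
      by (intro exI[of _ "t # us"] exI[of _ t'] exI[of _ vs]) (simp only: word_prod_simps comp_assoc, simp)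
  qed
qed

lemma coxeter_length_le: "ws \<in> lists S \<Longrightarrow> coxeter_length \<Delta> \<theta> (word_prod ws) \<le> length ws"
  unfolding coxeter_length_def by (rule Least_le) blast

lemma reduced_word:
  assumes "w \<in> W"
  obtains ws where "ws \<in> lists S" "word_prod ws = w" "length ws = coxeter_length \<Delta> \<theta> w"
proof -
  have "\<exists>k. \<exists>ws\<in>lists S. length ws = k \<and> word_prod ws = w"
    using assms unfolding affine_weyl_group_def by blast
  then show thesis
    using LeastI_ex[of "\<lambda>k. \<exists>ws\<in>lists S. length ws = k \<and> word_prod ws = w"] that
    unfolding coxeter_length_def by blast
qed

lemma origin_side:
  assumes y: "y \<in> W" and less: "coxeter_length \<Delta> \<theta> y < coxeter_length \<Delta> \<theta> (y \<circ> s)"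
    and wall: "{v. a \<bullet> v = b} \<in> walls \<Phi>" and a: "a \<noteq> 0"
    and side: "y ` A\<^sub>0 \<subseteq> {v. a \<bullet> v \<le> b}" and refl: "affine_refl a b \<circ> y = y \<circ> s"
  shows "0 \<le> b"
proof (rule ccontr)
  assume "\<not> 0 \<le> b"
  then have "\<not> A\<^sub>0 \<subseteq> {v. a \<bullet> v \<le> b}"
    using origin_fundamental_alcove by auto
  then have "A\<^sub>0 \<subseteq> {v. a \<bullet> v \<ge> b}"
    using alcove_one_side[OF fundamental_alcove_alcove wall] by satx
  then have id_side: "id ` A\<^sub>0 \<subseteq> {v. a \<bullet> v \<ge> b}"
    by (simp only: image_id id_apply)
  have id_W: "id \<in> W"
    unfolding affine_weyl_group_def by (rule image_eqI[of _ _ "[]"]) simp_all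
  obtain ws where ws: "ws \<in> lists S" "word_prod ws = y" "length ws = coxeter_length \<Delta> \<theta> y"
    using reduced_word[OF y] by metis
  have "\<exists>us t vs. ws = us @ t # vs \<and> t \<in> S \<and> us \<in> lists S \<and> vs \<in> lists S \<and>
    affine_refl a b \<circ> (id \<circ> word_prod us) = id \<circ> word_prod us \<circ> t"
    by (rule gallery_crossing[OF wall a ws(1) id_W id_side]) (simp only: id_comp ws(2) side)
  then obtain us t vs where us: "ws = us @ t # vs" "t \<in> S" "us \<in> lists S" "vs \<in> lists S"
    and eq: "affine_refl a b \<circ> word_prod us = word_prod us \<circ> t"
    unfolding id_comp by blast
  have "y = word_prod us \<circ> t \<circ> word_prod vs"
    unfolding ws(2)[symmetric] us(1) by (simp only: word_prod_append word_prod_simps comp_assoc)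
  then have "y \<circ> s = affine_refl a b \<circ> word_prod us \<circ> t \<circ> word_prod vs"
    using refl by (simp only: comp_assoc)
  also have "\<dots> = word_prod us \<circ> (t \<circ> t) \<circ> word_prod vs"
    unfolding eq by (simp only: comp_assoc)
  also have "\<dots> = word_prod (us @ vs)"
    unfolding simple_reflection_invol[OF us(2)] word_prod_append comp_id ..
  finally have "coxeter_length \<Delta> \<theta> (y \<circ> s) \<le> length (us @ vs)"
    using coxeter_length_le[of "us @ vs"] us(3,4) by simp
  also have "\<dots> < length ws"
    using us(1) by simp
  finally show False
    using less ws(3) by simp
qed

end

section \<open>Reflecting pieces of galleries\<close>

locale adjacent_alcoves = affine_weyl \<Phi> \<Delta> \<theta> for \<Phi> \<Delta> :: "'a::euclidean_space set" and \<theta> :: 'a +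
  fixes a :: 'a and b :: real and C D :: "'a set"
  assumes normal_nonzero: "a \<noteq> 0"
    and wall: "{v. a \<bullet> v = b} \<in> walls \<Phi>"
    and alcoves: "C \<in> alcoves \<Phi>" "D \<in> alcoves \<Phi>"
    and sides: "\<And>v. v \<in> C \<Longrightarrow> a \<bullet> v \<le> b" "\<And>v. v \<in> D \<Longrightarrow> b \<le> a \<bullet> v"
    and refl_W: "affine_refl a b \<in> W"
    and refl_C: "affine_refl a b ` C = D"
    and separates_unique: "\<And>M. separates M C D \<Longrightarrow> M = {v. a \<bullet> v = b}"
    and origin: "0 \<le> b"
begin

abbreviation "r \<equiv> affine_refl a b"
abbreviation "H \<equiv> {v. a \<bullet> v = b}"

definition half :: "bool \<Rightarrow> 'a set" where
  "half p = (if p then {v. b \<le> a \<bullet> v} else {v. a \<bullet> v \<le> b})"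

definition beyond :: "'a set \<Rightarrow> bool" where
  "beyond c \<longleftrightarrow> c \<subseteq> half True"

definition reflect_if :: "bool \<Rightarrow> 'a set \<Rightarrow> 'a set" where
  "reflect_if p X = (if p then r ` X else X)"

lemma refl_refl [simp]: "r (r v) = v"
  by (rule affine_refl_invol[OF normal_nonzero])

lemma refl_image_image: "r ` r ` X = X"
  by (simp add: image_image)

lemma refl_half: "v \<in> half p \<Longrightarrow> r v \<in> half (\<not> p)"
  using affine_refl_functional[OF normal_nonzero, of b v] by (auto simp: half_def split: if_splits)

lemma half_Int: "v \<in> half p \<Longrightarrow> v \<in> half (\<not> p) \<Longrightarrow> v \<in> H"
  by (auto simp: half_def split: if_splits)

lemma half_unique:
  assumes "c \<in> alcoves \<Phi>" "c \<subseteq> half p" "c \<subseteq> half q"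
  shows "p = q"
proof (rule ccontr)
  assume "p \<noteq> q"
  then have q: "q = (\<not> p)" by simp
  obtain v where "v \<in> c" "a \<bullet> v \<noteq> b"
    using alcove_not_subset_hyperplane[OF assms(1) normal_nonzero] by metis
  then show False
    using half_Int[of v p] assms(2,3) unfolding q by auto
qed

lemma alcove_half:
  assumes "c \<in> alcoves \<Phi>"
  shows "c \<subseteq> half (beyond c)"
proof (cases "beyond c")
  case True
  then show ?thesis by (simp add: beyond_def)
next
  case False
  then show ?thesis
    using alcove_one_side[OF assms wall] by (simp add: beyond_def half_def)
qed

lemma beyond_eq_common_face:
  assumes "c \<in> alcoves \<Phi>" "c' \<in> alcoves \<Phi>" "F \<subseteq> c" "F \<subseteq> c'" "\<not> F \<subseteq> H"
  shows "beyond c = beyond c'"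
proof (rule ccontr)
  assume neq: "beyond c \<noteq> beyond c'"
  obtain x where x: "x \<in> F" "x \<notin> H"
    using assms(5) by blast
  have "x \<in> half (beyond c)" "x \<in> half (beyond c')"
    using x(1) assms alcove_half by blast+
  moreover have "beyond c' = (\<not> beyond c)"
    using neq by simp
  ultimately have "x \<in> H"
    using half_Int by simp
  then show False
    using x(2) by simp
qed

lemma refl_affine_isometry: "affine_isometry r"
  by (rule affine_isometry_affine_refl[OF normal_nonzero])

lemma reflect_if_subset_wall: "F \<subseteq> H \<Longrightarrow> reflect_if p F = F"
  using affine_refl_eq_iff[OF normal_nonzero, of b] by (force simp: reflect_if_def image_iff)

lemma reflect_if_half: "c \<subseteq> half q \<Longrightarrow> reflect_if p c \<subseteq> half (p \<noteq> q)"
  using refl_half[of _ q] by (cases p) (auto simp: reflect_if_def)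

lemma reflect_if_alcove: "c \<in> alcoves \<Phi> \<Longrightarrow> reflect_if p c \<in> alcoves \<Phi>"
  by (simp add: reflect_if_def W_alcove[OF refl_W])

lemma reflect_if_facet: "reflect_if p F facet_of reflect_if p c \<longleftrightarrow> F facet_of c"
  by (simp add: reflect_if_def facet_of_affine_isometry[OF refl_affine_isometry])

lemma reflect_if_mono: "X \<subseteq> Y \<Longrightarrow> reflect_if p X \<subseteq> reflect_if p Y"
  by (auto simp: reflect_if_def)

lemma reflect_if_eq_iff: "reflect_if p X = reflect_if p Y \<longleftrightarrow> X = Y"
  by (metis refl_image_image reflect_if_def)

lemma reflect_if_simplex: "apartment_simplex \<Phi> F \<Longrightarrow> apartment_simplex \<Phi> (reflect_if p F)"
  using W_alcove[OF refl_W] facet_of_affine_isometry(1)[OF refl_affine_isometry]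
  unfolding apartment_simplex_def reflect_if_def by (metis image_is_empty)

lemma simplex_type_refl: "simplex_type \<Delta> \<theta> F \<subseteq> simplex_type \<Delta> \<theta> (r ` F)"
proof
  fix s assume "s \<in> simplex_type \<Delta> \<theta> F"
  then obtain w G where s: "s \<in> S" "w \<in> W" "G face_of A\<^sub>0" "F = w ` G" "\<forall>v\<in>G. s v = v"
    unfolding simplex_type_def by blast
  moreover have "r ` F = (r \<circ> w) ` G"
    unfolding s(4) by (rule image_comp)
  ultimately show "s \<in> simplex_type \<Delta> \<theta> (r ` F)"
    unfolding simplex_type_def using W_comp[OF refl_W s(2)] by blast
qed

lemma simplex_type_reflect_if: "simplex_type \<Delta> \<theta> (reflect_if p F) = simplex_type \<Delta> \<theta> F"
  using simplex_type_refl[of F] simplex_type_refl[of "r ` F"]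
  unfolding reflect_if_def refl_image_image by auto

lemma affine_hull_facet_subset_wall:
  assumes c: "c \<in> alcoves \<Phi>" and F: "F facet_of c" and "F \<subseteq> H"
  shows "affine hull F = H"
proof (rule affine_dim_equal)
  show "affine hull F \<subseteq> H"
    using \<open>F \<subseteq> H\<close> by (intro hull_minimal affine_hyperplane)
  show "affine hull F \<noteq> {}"
    using F by (simp add: facet_of_def)
  show "aff_dim (affine hull F) = aff_dim H"
    using F aff_dim_nonempty_interior[OF alcove_interior[OF c]] normal_nonzero
    by (simp add: facet_of_def)
qed (simp_all add: affine_hyperplane)

lemma separates_switch:
  assumes M: "M \<in> walls \<Phi>" "M \<noteq> H" and E: "E \<in> {C, D}" "E' \<in> {C, D}" and sep: "separates M c E"
  shows "separates M c E'"
proof -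
  obtain a' b' where a': "a' \<noteq> 0" "M = {v. a' \<bullet> v = b'}"
    "\<And>v. v \<in> c \<Longrightarrow> a' \<bullet> v \<le> b'" "\<And>v. v \<in> E \<Longrightarrow> a' \<bullet> v \<ge> b'"
    using separatesE[OF sep] by metis
  have "E' \<in> alcoves \<Phi>"
    using E(2) alcoves by auto
  then consider "E' \<subseteq> {v. a' \<bullet> v \<ge> b'}" | "E' \<subseteq> {v. a' \<bullet> v \<le> b'}"
    using alcove_one_side M(1) unfolding a'(2) by metis
  then show ?thesis
  proof cases
    case 1
    show ?thesis
      using a'(1,2,3)
    proof (rule separatesI)
      show "a' \<bullet> v \<ge> b'" if "v \<in> E'" for v
        using subsetD[OF 1 that] by simp
    qed
  next
    case 2
    have "separates M E' E"
      using a'(1,2)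
    proof (rule separatesI)
      show "a' \<bullet> v \<le> b'" if "v \<in> E'" for v
        using subsetD[OF 2 that] by simp
    qed (rule a'(4))
    then have "E' = E"
      using E M(2) separates_unique separates_sym by blast
    then show ?thesis
      using sep by simp
  qed
qed

lemma separates_reflect_if:
  assumes c: "c \<in> alcoves \<Phi>" and F: "F facet_of c" "\<not> F \<subseteq> H"
    and E: "E \<in> {C, D}" "E' \<in> {C, D}" and sep: "separates (affine hull F) c E"
  shows "separates (affine hull (reflect_if p F)) (reflect_if p c) E'"
proof -
  have aff: "affine hull G \<in> walls \<Phi>" "affine hull G \<noteq> H" if "G facet_of d" "d \<in> alcoves \<Phi>" "\<not> G \<subseteq> H" for G d
    using alcove_facet_wall[OF that(2,1)] that(3) hull_subset[of G affine] by auto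
  show ?thesis
  proof (cases p)
    case False
    then show ?thesis
      using separates_switch[OF aff[OF F(1) c F(2)] E sep] by (simp add: reflect_if_def)
  next
    case True
    have "\<not> r ` F \<subseteq> H"
      using F(2) reflect_if_subset_wall[of "r ` F" True] refl_image_image[of F]
      by (auto simp: reflect_if_def)
    moreover have "r ` F facet_of r ` c" "r ` c \<in> alcoves \<Phi>"
      using facet_of_affine_isometry(2)[OF refl_affine_isometry] F(1) W_alcove[OF refl_W c] by auto
    ultimately have M: "affine hull (r ` F) \<in> walls \<Phi>" "affine hull (r ` F) \<noteq> H"
      using aff by blast+
    have "separates (r ` (affine hull F)) (r ` c) (r ` C)"
      using separates_switch[OF aff[OF F(1) c F(2)] E(1) _ sep, of C]
      by (intro separates_affine_isometry refl_affine_isometry W_bij refl_W) simp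
    then have "separates (affine hull (r ` F)) (r ` c) D"
      by (simp only: refl_C affine_hull_affine_isometry[OF refl_affine_isometry])
    then have "separates (affine hull (r ` F)) (r ` c) E'"
      by (rule separates_switch[OF M _ E(2), rotated]) simp
    then show ?thesis
      using True by (simp add: reflect_if_def)
  qed
qed

lemma galleryD:
  assumes "is_gallery \<Phi> g" and n: "n = gallery_length g"
  shows "0 < n" "length (faces g) = Suc n"
    "\<And>i. i < n \<Longrightarrow> chambers g ! i \<in> alcoves \<Phi>"
    "first_face g = faces g ! 0" "last_face g = faces g ! n"
    "apartment_simplex \<Phi> (faces g ! 0)" "apartment_simplex \<Phi> (faces g ! n)"
    "faces g ! 0 \<subseteq> chambers g ! 0" "faces g ! n \<subseteq> chambers g ! (n - 1)"
    "\<And>i. 1 \<le> i \<Longrightarrow> i < n \<Longrightarrow> faces g ! i facet_of chambers g ! (i - 1)"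
    "\<And>i. 1 \<le> i \<Longrightarrow> i < n \<Longrightarrow> faces g ! i facet_of chambers g ! i"
proof -
  have g: "chambers g \<noteq> []" "length (faces g) = Suc n" "faces g \<noteq> []"
    using assms by (auto simp: is_gallery_def)
  have hd: "hd (faces g) = faces g ! 0" "last (faces g) = faces g ! n"
    "hd (chambers g) = chambers g ! 0" "last (chambers g) = chambers g ! (n - 1)"
    using g n by (simp_all add: hd_conv_nth last_conv_nth)
  show "0 < n" "length (faces g) = Suc n" "first_face g = faces g ! 0" "last_face g = faces g ! n"
    using g n hd by simp_all
  show "chambers g ! i \<in> alcoves \<Phi>" if "i < n" for i
    using assms that by (auto simp: is_gallery_def)
  show "apartment_simplex \<Phi> (faces g ! 0)" "apartment_simplex \<Phi> (faces g ! n)"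
    "faces g ! 0 \<subseteq> chambers g ! 0" "faces g ! n \<subseteq> chambers g ! (n - 1)"
    using assms(1) unfolding is_gallery_def hd by simp_all
  show "faces g ! i facet_of chambers g ! (i - 1)" "faces g ! i facet_of chambers g ! i"
    if "1 \<le> i" "i < n" for i
    using assms that by (simp_all add: is_gallery_def)
qed

text \<open>Here \<open>d i\<close> prescribes the side of \<open>H\<close> to which the \<open>i\<close>-th alcove is moved.\<close>

lemma reflect_pieces:
  assumes g: "is_gallery \<Phi> g" and first: "first_face g = {0}" and last: "last_face g = {v}"
    and E: "E \<in> {C, D}" "E' \<in> {C, D}" and pos: "positively_folded E g"
    and n: "n = gallery_length g" and d0: "\<not> d 0"
    and d: "\<And>i. 1 \<le> i \<Longrightarrow> i < n \<Longrightarrow> \<not> faces g ! i \<subseteq> H \<Longrightarrow> d (i - 1) = d i"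
    and fold: "\<And>i. 1 \<le> i \<Longrightarrow> i < n \<Longrightarrow> faces g ! i \<subseteq> H \<Longrightarrow> d (i - 1) = d i \<Longrightarrow> E' \<subseteq> half (\<not> d i)"
  obtains g' where "is_gallery \<Phi> g'" "first_face g' = {0}"
    "last_face g' = {if beyond (chambers g ! (n - 1)) = d (n - 1) then v else r v}"
    "gallery_type \<Delta> \<theta> g' = gallery_type \<Delta> \<theta> g" "positively_folded E' g'"
proof
  note G = galleryD[OF g n]
  define e where "e i = (beyond (chambers g ! i) \<noteq> d i)" for i
  define P where "P = map (\<lambda>i. reflect_if (e (min i (n - 1))) (faces g ! i)) [0..<Suc n]"
  define K where "K = map (\<lambda>i. reflect_if (e i) (chambers g ! i)) [0..<n]"
  have len: "length P = Suc n" "length K = n"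
    by (simp_all add: P_def K_def)
  have K: "K ! i = reflect_if (e i) (chambers g ! i)" if "i < n" for i
    using that by (simp add: K_def)
  have Pn: "P ! n = reflect_if (e (n - 1)) (faces g ! n)"
    unfolding P_def by (subst nth_map) (simp_all del: upt_Suc)
  have P: "P ! i = reflect_if (e i) (faces g ! i)" if "i < n" for i
  proof -
    have "min i (n - 1) = i"
      using that by simp
    then show ?thesis
      using that unfolding P_def by (subst nth_map) (simp_all del: upt_Suc)
  qed
  have e_const: "e (i - 1) = e i" if i: "1 \<le> i" "i < n" "\<not> faces g ! i \<subseteq> H" for i
  proof -
    have "beyond (chambers g ! (i - 1)) = beyond (chambers g ! i)"
      using i G(10,11)[of i] facet_of_imp_subset
      by (intro beyond_eq_common_face[of _ _ "faces g ! i"] G(3)) auto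
    then show ?thesis
      using d[OF i] by (simp add: e_def)
  qed
  have P': "P ! i = reflect_if (e (i - 1)) (faces g ! i)" if "1 \<le> i" "i < n" for i
    using P[OF that(2)] e_const[OF that] reflect_if_subset_wall by (cases "faces g ! i \<subseteq> H") auto
  have K_half: "K ! i \<subseteq> half (d i)" if "i < n" for i
  proof -
    have "K ! i \<subseteq> half (e i \<noteq> beyond (chambers g ! i))"
      unfolding K[OF that] by (intro reflect_if_half alcove_half G(3) that)
    moreover have "(e i \<noteq> beyond (chambers g ! i)) = d i"
      by (auto simp: e_def)
    ultimately show ?thesis
      by simp
  qed
  have ends: "hd P = P ! 0" "last P = P ! n" "hd K = K ! 0" "last K = K ! (n - 1)"
    "P \<noteq> []" "K \<noteq> []"
    using len G(1) by (auto simp: hd_conv_nth last_conv_nth simp flip: length_greater_0_conv)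
  have K_alcove: "K ! i \<in> alcoves \<Phi>" if "i < n" for i
    using that by (simp add: K reflect_if_alcove G(3))
  show "is_gallery \<Phi> (P, K)"
    unfolding is_gallery_def fst_conv snd_conv ends len
  proof (intro conjI allI impI)
    show "set K \<subseteq> alcoves \<Phi>"
      using K_alcove by (auto simp: in_set_conv_nth len)
    show "apartment_simplex \<Phi> (P ! 0)" "P ! 0 \<subseteq> K ! 0"
      using G(1,6,8) by (simp_all add: P K reflect_if_simplex reflect_if_mono)
    show "apartment_simplex \<Phi> (P ! n)" "P ! n \<subseteq> K ! (n - 1)"
      using G(1,7,9) by (simp_all add: Pn K reflect_if_simplex reflect_if_mono)
    fix i assume "1 \<le> i \<and> i < n"
    then have i: "1 \<le> i" "i < n" "i - 1 < n" by auto
    show "P ! i facet_of K ! (i - 1)"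
      unfolding P'[OF i(1,2)] K[OF i(3)] reflect_if_facet by (rule G(10)[OF i(1,2)])
    show "P ! i facet_of K ! i"
      unfolding P[OF i(2)] K[OF i(2)] reflect_if_facet by (rule G(11)[OF i(1,2)])
  qed (use ends in simp_all)
  have face0: "faces g ! 0 = {0}" and facen: "faces g ! n = {v}"
    using first last G(4,5) by simp_all
  have "P ! 0 = {0}"
  proof (cases "e 0")
    case False
    then show ?thesis
      using P[OF G(1)] face0 by (simp add: reflect_if_def)
  next
    case True
    have "0 \<in> half True"
      using True d0 G(8) face0 by (auto simp: e_def beyond_def)
    then have "faces g ! 0 \<subseteq> H"
      using origin face0 by (simp add: half_def)
    then show ?thesis
      using P[OF G(1)] face0 reflect_if_subset_wall by simp
  qed
  then show "first_face (P, K) = {0}"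
    by (simp add: ends)
  have "P ! n = {if beyond (chambers g ! (n - 1)) = d (n - 1) then v else r v}"
    unfolding Pn facen by (simp add: e_def reflect_if_def)
  then show "last_face (P, K) = {if beyond (chambers g ! (n - 1)) = d (n - 1) then v else r v}"
    by (simp add: ends)
  have "map (simplex_type \<Delta> \<theta>) P = map (simplex_type \<Delta> \<theta>) (faces g)"
  proof (rule nth_equalityI)
    fix i assume "i < length (map (simplex_type \<Delta> \<theta>) P)"
    then have i: "i < Suc n" by (simp add: len)
    then have "P ! i = reflect_if (e (min i (n - 1))) (faces g ! i)"
      unfolding P_def by (subst nth_map) (simp_all del: upt_Suc)
    then show "map (simplex_type \<Delta> \<theta>) P ! i = map (simplex_type \<Delta> \<theta>) (faces g) ! i"
      using i len(1) G(2) by (simp add: simplex_type_reflect_if)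
  qed (simp add: len G(2))
  then show "gallery_type \<Delta> \<theta> (P, K) = gallery_type \<Delta> \<theta> g"
    by (simp add: gallery_type_def)
  show "positively_folded E' (P, K)"
    unfolding positively_folded_def fst_conv snd_conv
  proof (intro allI impI)
    fix i assume "folded_at (P, K) i"
    then have i: "1 \<le> i" "i < n" "i - 1 < n" and eq: "K ! (i - 1) = K ! i"
      by (auto simp: folded_at_def len)
    have di: "d (i - 1) = d i"
      using half_unique[OF K_alcove[OF i(2)] K_half[OF i(2)]] K_half[OF i(3)] eq by metis
    show "separates (affine hull (P ! i)) (K ! i) E'"
    proof (cases "faces g ! i \<subseteq> H")
      case True
      have "affine hull (P ! i) = H"
        using affine_hull_facet_subset_wall[OF G(3)[OF i(2)] G(11)[OF i(1,2)] True]
          reflect_if_subset_wall[OF True] P[OF i(2)] by simp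
      moreover have "separates H X Y" if "X \<subseteq> half p" "Y \<subseteq> half (\<not> p)" for X Y p
      proof (cases p)
        case False
        show ?thesis
          by (rule separatesI[OF normal_nonzero HOL.refl]) (use that False in \<open>auto simp: half_def\<close>)
      next
        case True
        show ?thesis
          by (rule separates_sym, rule separatesI[OF normal_nonzero HOL.refl])
             (use that True in \<open>auto simp: half_def\<close>)
      qed
      ultimately show ?thesis
        using K_half[OF i(2)] fold[OF i(1,2) True di] by simp
    next
      case False
      have "reflect_if (e i) (chambers g ! (i - 1)) = reflect_if (e i) (chambers g ! i)"
        using eq e_const[OF i(1,2) False] K i by simp
      then have "folded_at g i"
        using i n by (simp add: folded_at_def reflect_if_eq_iff)
      then have "separates (affine hull (faces g ! i)) (chambers g ! i) E"
        using pos by (simp add: positively_folded_def)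
      then show ?thesis
        unfolding P[OF i(2)] K[OF i(2)]
        by (rule separates_reflect_if[OF G(3)[OF i(2)] G(11)[OF i(1,2)] False E])
    qed
  qed
qed

definition shadow_of :: "('a \<Rightarrow> 'a) set list \<Rightarrow> 'a set \<Rightarrow> 'a set" where
  "shadow_of \<tau> E =
     {v. \<exists>g. is_gallery \<Phi> g \<and> first_face g = {0} \<and> last_face g = {v} \<and>
             gallery_type \<Delta> \<theta> g = \<tau> \<and> positively_folded E g}"

lemma shadow_ofI:
  "is_gallery \<Phi> g \<Longrightarrow> first_face g = {0} \<Longrightarrow> last_face g = {v} \<Longrightarrow> gallery_type \<Delta> \<theta> g = \<tau> \<Longrightarrow>
    positively_folded E g \<Longrightarrow> v \<in> shadow_of \<tau> E"
  unfolding shadow_of_def by blast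

lemma positively_folded_switch:
  assumes g: "is_gallery \<Phi> g" and E: "E \<in> {C, D}" "E' \<in> {C, D}" and pos: "positively_folded E g"
    and "\<And>i. 1 \<le> i \<Longrightarrow> i < gallery_length g \<Longrightarrow> \<not> faces g ! i \<subseteq> H"
  shows "positively_folded E' g"
  unfolding positively_folded_def
proof (intro allI impI)
  fix i assume i: "folded_at g i"
  then have i': "1 \<le> i" "i < gallery_length g"
    by (auto simp: folded_at_def)
  note G = galleryD[OF g HOL.refl]
  have "separates (affine hull (faces g ! i)) (chambers g ! i) E"
    using pos i by (simp add: positively_folded_def)
  then show "separates (affine hull (faces g ! i)) (chambers g ! i) E'"
    using separates_reflect_if[OF G(3)[OF i'(2)] G(11)[OF i'] assms(5)[OF i'] E, of False]
    by (simp add: reflect_if_def)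
qed

lemma sides_half: "C \<subseteq> half False" "D \<subseteq> half True"
  using sides by (auto simp: half_def)

lemma last_vertex_half:
  assumes "is_gallery \<Phi> g" "last_face g = {v}"
  shows "v \<in> half (beyond (chambers g ! (gallery_length g - 1)))"
proof -
  note G = galleryD[OF assms(1) HOL.refl]
  have "v \<in> chambers g ! (gallery_length g - 1)"
    using G(9) unfolding G(5)[symmetric] assms(2) by simp
  then show ?thesis
    using subsetD[OF alcove_half[OF G(3)]] diff_less[OF zero_less_one G(1)] by blast
qed

lemma shadow_fold:
  assumes g: "is_gallery \<Phi> g" "first_face g = {0}" "last_face g = {v}"
    "gallery_type \<Delta> \<theta> g = \<tau>" "positively_folded C g"
  shows "(if beyond (chambers g ! (gallery_length g - 1)) then r v else v) \<in> shadow_of \<tau> D"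
proof -
  \<comment> \<open>All pieces are moved to the side of \<open>C\<close>.\<close>
  obtain g' where g': "is_gallery \<Phi> g'" "first_face g' = {0}"
    "last_face g' = {if beyond (chambers g ! (gallery_length g - 1)) = False then v else r v}"
    "gallery_type \<Delta> \<theta> g' = gallery_type \<Delta> \<theta> g" "positively_folded D g'"
    by (rule reflect_pieces[OF g(1-3) _ _ g(5) HOL.refl, of D "\<lambda>_. False"]) (use sides_half in simp_all)
  have "(if beyond (chambers g ! (gallery_length g - 1)) = False then v else r v) \<in> shadow_of \<tau> D"
    using g'(1-3) g'(4)[unfolded g(4)] g'(5) by (rule shadow_ofI)
  then show ?thesis
    by (simp split: if_splits)
qed

lemma shadow_mono: "shadow_of \<tau> C \<subseteq> shadow_of \<tau> D"
proof
  fix v assume "v \<in> shadow_of \<tau> C"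
  then obtain g where g: "is_gallery \<Phi> g" "first_face g = {0}" "last_face g = {v}"
    "gallery_type \<Delta> \<theta> g = \<tau>" "positively_folded C g"
    by (auto simp: shadow_of_def)
  let ?n = "gallery_length g"
  consider "\<not> beyond (chambers g ! (?n - 1))"
    | "\<And>i. 1 \<le> i \<Longrightarrow> i < ?n \<Longrightarrow> \<not> faces g ! i \<subseteq> H"
    | i where "beyond (chambers g ! (?n - 1))" "1 \<le> i" "i < ?n" "faces g ! i \<subseteq> H"
    by blast
  then show "v \<in> shadow_of \<tau> D"
  proof cases
    case 1
    then show ?thesis
      using shadow_fold[OF g] by simp
  next
    case 2
    have "positively_folded D g"
      by (rule positively_folded_switch[OF g(1) _ _ g(5) 2]) simp_all
    then show ?thesis
      by (rule shadow_ofI[OF g(1-4)])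
  next
    case 3
    \<comment> \<open>The last piece is kept beyond \<open>H\<close>, all others are moved to the side of \<open>C\<close>.\<close>
    define d where "d i \<longleftrightarrow> (\<forall>j. i < j \<and> j < ?n \<longrightarrow> \<not> faces g ! j \<subseteq> H)" for i
    have d_step: "d (i - 1) \<longleftrightarrow> d i \<and> \<not> faces g ! i \<subseteq> H" if "1 \<le> i" "i < ?n" for i
    proof -
      have "i - 1 < j \<longleftrightarrow> j = i \<or> i < j" for j
        using that(1) by auto
      then show ?thesis
        unfolding d_def using that(2) by metis
    qed
    have d_last: "d (?n - 1)"
      unfolding d_def by auto
    obtain g' where g': "is_gallery \<Phi> g'" "first_face g' = {0}"
      "last_face g' = {if beyond (chambers g ! (?n - 1)) = d (?n - 1) then v else r v}"
      "gallery_type \<Delta> \<theta> g' = gallery_type \<Delta> \<theta> g" "positively_folded D g'"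
    proof (rule reflect_pieces[OF g(1-3) _ _ g(5) HOL.refl, of D d])
      show "\<not> d 0"
        unfolding d_def using 3(2-4) by (intro notI) (auto dest!: spec[of _ i])
    qed (use d_step sides_half in auto)
    have "last_face g' = {v}"
      using g'(3) 3(1) d_last by simp
    then show ?thesis
      using g' g(4) by (intro shadow_ofI[of g']) simp_all
  qed
qed

lemma shadow_reflect: "v \<in> shadow_of \<tau> C \<Longrightarrow> v \<in> half True \<Longrightarrow> r v \<in> shadow_of \<tau> D"
proof -
  assume "v \<in> shadow_of \<tau> C" and v: "v \<in> half True"
  then obtain g where g: "is_gallery \<Phi> g" "first_face g = {0}" "last_face g = {v}"
    "gallery_type \<Delta> \<theta> g = \<tau>" "positively_folded C g"
    by (auto simp: shadow_of_def)
  show "r v \<in> shadow_of \<tau> D"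
  proof (cases "beyond (chambers g ! (gallery_length g - 1))")
    case True
    then show ?thesis
      using shadow_fold[OF g] by simp
  next
    case False
    then have "v \<in> H"
      using last_vertex_half[OF g(1,3)] half_Int[of v True] v by simp
    then have "r v = v"
      using affine_refl_eq_iff[OF normal_nonzero] by simp
    then show ?thesis
      using shadow_fold[OF g] False by simp
  qed
qed

lemma shadow_subset: "shadow_of \<tau> D \<subseteq> shadow_of \<tau> C \<union> r ` (half True \<inter> shadow_of \<tau> C)"
proof
  fix v assume "v \<in> shadow_of \<tau> D"
  then obtain g where g: "is_gallery \<Phi> g" "first_face g = {0}" "last_face g = {v}"
    "gallery_type \<Delta> \<theta> g = \<tau>" "positively_folded D g"
    by (auto simp: shadow_of_def)
  let ?n = "gallery_length g"
  consider "\<And>i. 1 \<le> i \<Longrightarrow> i < ?n \<Longrightarrow> \<not> faces g ! i \<subseteq> H"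
    | i where "1 \<le> i" "i < ?n" "faces g ! i \<subseteq> H"
    by blast
  then show "v \<in> shadow_of \<tau> C \<union> r ` (half True \<inter> shadow_of \<tau> C)"
  proof cases
    case 1
    have "positively_folded C g"
      by (rule positively_folded_switch[OF g(1) _ _ g(5) 1]) simp_all
    then show ?thesis
      using shadow_ofI[OF g(1-4)] by blast
  next
    case 2
    \<comment> \<open>The first piece is moved to the side of \<open>C\<close>, all others beyond \<open>H\<close>.\<close>
    define d where "d i \<longleftrightarrow> (\<exists>j. 1 \<le> j \<and> j \<le> i \<and> faces g ! j \<subseteq> H)" for i
    have d_step: "d i \<longleftrightarrow> d (i - 1) \<or> faces g ! i \<subseteq> H" if "1 \<le> i" for i
    proof -
      have "j \<le> i \<longleftrightarrow> j = i \<or> j \<le> i - 1" for j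
        using that by auto
      then show ?thesis
        unfolding d_def using that by metis
    qed
    have d_last: "d (?n - 1)"
      unfolding d_def using 2 by auto
    obtain g' where g': "is_gallery \<Phi> g'" "first_face g' = {0}"
      "last_face g' = {if beyond (chambers g ! (?n - 1)) = d (?n - 1) then v else r v}"
      "gallery_type \<Delta> \<theta> g' = gallery_type \<Delta> \<theta> g" "positively_folded C g'"
    proof (rule reflect_pieces[OF g(1-3) _ _ g(5) HOL.refl, of C d])
      show "\<not> d 0"
        unfolding d_def by auto
    qed (use d_step sides_half in auto)
    have mem: "(if beyond (chambers g ! (?n - 1)) then v else r v) \<in> shadow_of \<tau> C"
      using g' g(4) d_last by (intro shadow_ofI[of g']) simp_all
    show ?thesis
    proof (cases "beyond (chambers g ! (?n - 1))")
      case True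
      then show ?thesis
        using mem by simp
    next
      case False
      then have "r v \<in> half True" "r v \<in> shadow_of \<tau> C"
        using mem last_vertex_half[OF g(1,3)] refl_half[of v False] by simp_all
      then show ?thesis
        by (intro UnI2 image_eqI[of _ _ "r v"]) simp_all
    qed
  qed
qed

theorem shadow_of_adjacent: "shadow_of \<tau> D = shadow_of \<tau> C \<union> r ` (half True \<inter> shadow_of \<tau> C)"
  using shadow_mono shadow_reflect shadow_subset by blast

lemma half_apartment_eq: "half_apartment H D = half True"
proof (intro subset_antisym subsetI)
  fix x assume "x \<in> half True"
  then have "- a \<noteq> 0 \<and> H = {v. - a \<bullet> v = - b} \<and> D \<subseteq> {v. - a \<bullet> v \<le> - b} \<and> - a \<bullet> x \<le> - b"
    using normal_nonzero sides(2) by (auto simp: half_def)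
  then show "x \<in> half_apartment H D"
    unfolding half_apartment_def by blast
next
  fix x assume "x \<in> half_apartment H D"
  then obtain a' b' where a': "a' \<noteq> 0" "H = {v. a' \<bullet> v = b'}" "D \<subseteq> {v. a' \<bullet> v \<le> b'}" "a' \<bullet> x \<le> b'"
    unfolding half_apartment_def mem_Collect_eq by (elim exE conjE)
  obtain c where c: "c \<noteq> 0" "a' = c *\<^sub>R a" "b' = c * b"
    using hyperplane_eq_imp_scaled[OF normal_nonzero a'(1,2)] by metis
  obtain v where v: "v \<in> D" "a \<bullet> v \<noteq> b"
    using alcove_not_subset_hyperplane[OF alcoves(2) normal_nonzero] by metis
  have "c * (a \<bullet> v) \<le> c * b" "b < a \<bullet> v"
    using subsetD[OF a'(3) v(1)] sides(2)[OF v(1)] v(2) c by simp_all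
  then have "c < 0"
    using c(1) by (simp add: mult_le_cancel_left)
  then show "x \<in> half True"
    using a'(4) c by (simp add: half_def)
qed

end

theorem theorem1p1:
  fixes \<Phi> \<Delta> H :: "'a::euclidean_space set" and \<theta> lam \<alpha> :: 'a and k :: int
    and y s :: "'a \<Rightarrow> 'a" and g\<^sub>0 :: "'a gallery"
  assumes "irreducible_root_system \<Phi>" and "simple_roots \<Phi> \<Delta>" and "highest_root \<Phi> \<Delta> \<theta>"
    and "lam \<in> coroot_lattice \<Phi>"
    and "minimal_gallery \<Phi> g\<^sub>0" and "first_face g\<^sub>0 = {0}" and "last_face g\<^sub>0 = {lam}"
    and "y \<in> affine_weyl_group \<Delta> \<theta>" and "s \<in> simple_reflections \<Delta> \<theta>"
    and "coxeter_length \<Delta> \<theta> (y \<circ> s) > coxeter_length \<Delta> \<theta> y"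
    and "\<alpha> \<in> \<Phi>" and "H = hyperplane \<alpha> (of_int k)"
    and "separates H (y ` fundamental_alcove \<Delta> \<theta>) ((y \<circ> s) ` fundamental_alcove \<Delta> \<theta>)"
  shows "shadow \<Phi> \<Delta> \<theta> g\<^sub>0 (y \<circ> s) =
           shadow \<Phi> \<Delta> \<theta> g\<^sub>0 y \<union>
           affine_refl \<alpha> (of_int k) ` (half_apartment H ((y \<circ> s) ` fundamental_alcove \<Delta> \<theta>) \<inter> shadow \<Phi> \<Delta> \<theta> g\<^sub>0 y)"
proof -
  interpret affine_weyl \<Phi> \<Delta> \<theta>
    using assms(1-3) by unfold_locales
  let ?C = "y ` A\<^sub>0" and ?D = "(y \<circ> s) ` A\<^sub>0"
  obtain a b where a: "a \<noteq> 0" "H = {v. a \<bullet> v = b}"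
    and sides: "\<And>v. v \<in> ?C \<Longrightarrow> a \<bullet> v \<le> b" "\<And>v. v \<in> ?D \<Longrightarrow> a \<bullet> v \<ge> b"
    using separatesE[OF assms(13)] by metis
  have wall: "{v. a \<bullet> v = b} \<in> walls \<Phi>"
    unfolding a(2)[symmetric] walls_def
    by (intro CollectI exI[of _ \<alpha>] exI[of _ k] conjI assms(11,12))
  have ys: "y \<circ> s \<in> W"
    using W_comp[OF assms(8) W_simple_reflection[OF assms(9)]] .
  have conj: "affine_refl a b \<circ> y = y \<circ> s"
    using separates_adjacent_refl[OF assms(8,9) assms(13)[unfolded a(2)] a(1)] .
  obtain y' where y': "y' \<in> W" "y \<circ> y' = id"
    using W_inverse[OF assms(8)] by metis
  have "affine_refl a b = affine_refl a b \<circ> (y \<circ> y')"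
    unfolding y'(2) comp_id ..
  also have "\<dots> = y \<circ> s \<circ> y'"
    unfolding conj[symmetric] comp_assoc ..
  finally have refl_W: "affine_refl a b \<in> W"
    using W_comp[OF ys y'(1)] by simp
  interpret adjacent_alcoves \<Phi> \<Delta> \<theta> a b ?C ?D
  proof
    show "affine_refl a b ` ?C = ?D"
      unfolding image_comp conj ..
    show "M = {v. a \<bullet> v = b}" if "separates M ?C ?D" for M
      using separates_adjacent[OF assms(8,9)] that assms(13) unfolding a(2) by metis
    show "0 \<le> b"
      using origin_side[OF assms(8,10) wall a(1) _ conj] sides(1) by blast
  qed (use a(1) wall sides refl_W W_fundamental_alcove[OF assms(8)] W_fundamental_alcove[OF ys]
      in simp_all)
  have r: "affine_refl \<alpha> (of_int k) = affine_refl a b"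
    using affine_refl_cong_hyperplane[OF root_nonzero[OF assms(11)] a(1)] a(2) assms(12)
    by (simp add: hyperplane_def)
  have "shadow \<Phi> \<Delta> \<theta> g\<^sub>0 w = shadow_of (gallery_type \<Delta> \<theta> g\<^sub>0) (w ` A\<^sub>0)" for w
    unfolding shadow_def shadow_of_def ..
  then show ?thesis
    unfolding r a(2) half_apartment_eq by (simp only: shadow_of_adjacent)
qed

end
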